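(* (Central limit theorem with zero mean.) Let $\{X_i\}_{i=1}^{\infty}$ be a sequence of $\mathbb{R}^d$-valued random vectors on a sublinear expectation space $(\Omega,\mathcal{H},\mathbb{E})$. Assume that, for each $i=1,2,\dots$, $X_{i+1}\overset{d}{=}X_i$ and $X_{i+1}$ is independent from $(X_1,\dots,X_i)$, and that $\mathbb{E}[X_1]=\mathbb{E}[-X_1]=0$. Put $\bar S_n:=\frac1{\sqrt n}\sum_{i=1}^nX_i$. Then $\{\bar S_n\}$ converges in law to $X$, i.e. $$\lim_{n\to\infty}\mathbb{E}[\varphi(\bar S_n)]=\mathbb{E}[\varphi(X)]$$ for all $\varphi\in C(\mathbb{R}^d)$ satisfying the linear growth condition $|\varphi(x)|\le C(1+|x|)$, where $X$ is a $G$-normal distributed random vector whose associated sublinear function $A\mapsto\mathbb{E}[\frac12\langle AX,X\rangle]$ is $G:\mathbb{S}(d)\to\mathbb{R}$, $G(A):=\mathbb{E}[\frac12\langle AX_1,X_1\rangle]$.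
   Context: $\mathbb{S}(d)$ is the space of symmetric $d\times d$ real matrices. $C_{l.Lip}(\mathbb{R}^n)$ is the space of functions $\varphi:\mathbb{R}^n\to\mathbb{R}$ with $|\varphi(x)-\varphi(y)|\le C(1+|x|^m+|y|^m)|x-y|$ for some $C>0$, $m\in\mathbb{N}$ depending on $\varphi$. Sublinear expectation space $(\Omega,\mathcal{H},\mathbb{E})$: $\Omega$ is a set; $\mathcal{H}$ is a linear space of real functions on $\Omega$ containing the constants, with $|X|\in\mathcal{H}$ if $X\in\mathcal{H}$, and $\varphi(X_1,\dots,X_n)\in\mathcal{H}$ whenever $X_1,\dots,X_n\in\mathcal{H}$ and $\varphi\in C_{l.Lip}(\mathbb{R}^n)$; $\mathbb{E}:\mathcal{H}\to\mathbb{R}$ satisfies: $X\ge Y\Rightarrow\mathbb{E}[X]\ge\mathbb{E}[Y]$; $\mathbb{E}[c]=c$ for $c\in\mathbb{R}$; $\mathbb{E}[X+Y]\le\mathbb{E}[X]+\mathbb{E}[Y]$; $\mathbb{E}[\lambda X]=\lambda\mathbb{E}[X]$ for $\lambda\ge0$. An $n$-dimensional random vector is an element of $\mathcal{H}^n$; $\mathbb{E}$ of a vector is taken componentwise. Two $n$-dimensional random vectors $X_1,X_2$ on sublinear expectation spaces with expectations $\mathbb{E}_1,\mathbb{E}_2$ are identically distributed, $X_1\overset{d}{=}X_2$, if $\mathbb{E}_1[\varphi(X_1)]=\mathbb{E}_2[\varphi(X_2)]$ for all $\varphi\in C_{l.Lip}(\mathbb{R}^n)$. $Y\in\mathcal{H}^n$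 is independent from $X\in\mathcal{H}^m$ if $\mathbb{E}[\varphi(X,Y)]=\mathbb{E}[\mathbb{E}[\varphi(x,Y)]_{x=X}]$ for all $\varphi\in C_{l.Lip}(\mathbb{R}^{m+n})$. $\bar X$ is an independent copy of $X$ if $\bar X\overset{d}{=}X$ and $\bar X$ is independent from $X$ (realized, if necessary, on a product space). A $d$-dimensional random vector $X$ is $G$-normal distributed if $aX+b\bar X\overset{d}{=}\sqrt{a^2+b^2}\,X$ for all $a,b\ge0$, with $\bar X$ an independent copy of $X$; i.e. $\mathbb{E}[\mathbb{E}[\varphi(ax+bX)]_{x=X}]=\mathbb{E}[\varphi(\sqrt{a^2+b^2}X)]$ for all $\varphi\in C_{l.Lip}(\mathbb{R}^d)$. Its law is determined by $A\mapsto\frac12\mathbb{E}[\langle AX,X\rangle]$. Standing assumption: the space $(\Omega,\mathcal{H},\mathbb{E})$ carries the vector $X$ in question (otherwise $\mathbb{E}[\varphi(X)]$ is read on another sublinear expectation space carrying $X$). Convention: for $X\in\mathcal{H}^d$ and $\varphi$ continuous of linear growth, $\mathbb{E}[\varphi(X)]$ is the value of the continuous extension of $\mathbb{E}$ to the completion of $\mathcal{H}$ (modulo null elements) under $\mathbb{E}[|\cdot|]$; that is, $\mathbb{E}[\varphi(X)]=\lim_k\mathbb{E}[\varphi_k(X)]$ for any $\varphi_k\in C_{l.Lip}(\mathbb{R}^d)$ such that $|\varphi-\varphi_k|\le\psi_k$ with $\psi_k\in C_{l.Lip}(\mathbb{R}^d)$ and $\mathbb{E}[\psi_k(X)]\to0$.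 *)

theory Defs
  imports "HOL-Analysis.Analysis"
begin

text \<open>
  The Euclidean spaces that occur here are \<open>real ^ 'd\<close>, tuples of variable length, and products of
  these. A tuple \<open>(x j)\<close>, \<open>j \<in> J\<close>, is a total function \<open>x\<close> on \<open>nat\<close> of which only the entries in
  \<open>J\<close> matter, so its Euclidean norm is a seminorm on the function type. Therefore the class of
  locally Lipschitz functions takes the (semi)norm \<open>N\<close> as a parameter; the estimate forces
  \<open>\<phi> x = \<phi> y\<close> whenever \<open>N (x - y) = 0\<close>, so that for tuples its members are exactly the
  functions of the entries in \<open>J\<close>.
\<close>

definition C_lLip :: "('a::minus \<Rightarrow> real) \<Rightarrow> ('a \<Rightarrow> real) set" where
  "C_lLip N = {\<phi>. \<exists>C>0. \<exists>m::nat. \<forall>x y.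
     \<bar>\<phi> x - \<phi> y\<bar> \<le> C * (1 + N x ^ m + N y ^ m) * N (x - y)}"

definition tuple_norm :: "nat set \<Rightarrow> (nat \<Rightarrow> 'a::real_normed_vector) \<Rightarrow> real" where
  "tuple_norm J x = L2_set (\<lambda>j. norm (x j)) J"

definition pair_norm :: "('a \<Rightarrow> real) \<Rightarrow> ('b \<Rightarrow> real) \<Rightarrow> 'a \<times> 'b \<Rightarrow> real" where
  "pair_norm N M z = sqrt ((N (fst z))\<^sup>2 + (M (snd z))\<^sup>2)"

text \<open>
  The set \<open>\<Omega>\<close> is the type \<open>'w\<close>. The functional \<open>E\<close> is a total function, but only its values on
  \<open>H\<close> are constrained.
\<close>

locale sublinear_expectation_space =
  fixes H :: "('w \<Rightarrow> real) set" and E :: "('w \<Rightarrow> real) \<Rightarrow> real"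
  assumes const_mem: "(\<lambda>\<omega>. c) \<in> H"
    and add_mem: "X \<in> H \<Longrightarrow> Y \<in> H \<Longrightarrow> (\<lambda>\<omega>. X \<omega> + Y \<omega>) \<in> H"
    and scale_mem: "X \<in> H \<Longrightarrow> (\<lambda>\<omega>. c * X \<omega>) \<in> H"
    and abs_mem: "X \<in> H \<Longrightarrow> (\<lambda>\<omega>. \<bar>X \<omega>\<bar>) \<in> H"
    and comp_mem: "(\<And>i. i < n \<Longrightarrow> Xs i \<in> H) \<Longrightarrow> \<phi> \<in> C_lLip (tuple_norm {..<n}) \<Longrightarrow>
           (\<lambda>\<omega>. \<phi> (\<lambda>i. Xs i \<omega>)) \<in> H"
    and mono: "X \<in> H \<Longrightarrow> Y \<in> H \<Longrightarrow> (\<And>\<omega>. Y \<omega> \<le> X \<omega>) \<Longrightarrow> E Y \<le> E X"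
    and const: "E (\<lambda>\<omega>. c) = c"
    and subadd: "X \<in> H \<Longrightarrow> Y \<in> H \<Longrightarrow> E (\<lambda>\<omega>. X \<omega> + Y \<omega>) \<le> E X + E Y"
    and pos_hom: "X \<in> H \<Longrightarrow> 0 \<le> c \<Longrightarrow> E (\<lambda>\<omega>. c * X \<omega>) = c * E X"

definition random_vector :: "('w \<Rightarrow> real) set \<Rightarrow> ('w \<Rightarrow> real ^ 'd) \<Rightarrow> bool" where
  "random_vector H X \<longleftrightarrow> (\<forall>k. (\<lambda>\<omega>. X \<omega> $ k) \<in> H)"

definition vec_expectation :: "(('w \<Rightarrow> real) \<Rightarrow> real) \<Rightarrow> ('w \<Rightarrow> real ^ 'd) \<Rightarrow> real ^ 'd" where
  "vec_expectation E X = (\<chi> k. E (\<lambda>\<omega>. X \<omega> $ k))"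

definition identically_distributed ::
  "(('w \<Rightarrow> real) \<Rightarrow> real) \<Rightarrow> ('w \<Rightarrow> real ^ 'd) \<Rightarrow>
   (('v \<Rightarrow> real) \<Rightarrow> real) \<Rightarrow> ('v \<Rightarrow> real ^ 'd) \<Rightarrow> bool" where
  "identically_distributed E1 X1 E2 X2 \<longleftrightarrow>
     (\<forall>\<phi>\<in>C_lLip norm. E1 (\<lambda>\<omega>. \<phi> (X1 \<omega>)) = E2 (\<lambda>\<omega>. \<phi> (X2 \<omega>)))"

text \<open>\<open>Y\<close> is independent from \<open>X\<close>, where \<open>N\<close> and \<open>M\<close> are the Euclidean norms of the
  spaces in which \<open>X\<close> and \<open>Y\<close> take their values. The relation is not symmetric.\<close>

definition independent_from ::
  "(('w \<Rightarrow> real) \<Rightarrow> real) \<Rightarrow> ('b::minus \<Rightarrow> real) \<Rightarrow> ('w \<Rightarrow> 'b) \<Rightarrow>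
   ('a::minus \<Rightarrow> real) \<Rightarrow> ('w \<Rightarrow> 'a) \<Rightarrow> bool" where
  "independent_from E M Y N X \<longleftrightarrow>
     (\<forall>\<phi>\<in>C_lLip (pair_norm N M).
        E (\<lambda>\<omega>. \<phi> (X \<omega>, Y \<omega>)) = E (\<lambda>\<omega>. E (\<lambda>\<omega>'. \<phi> (X \<omega>, Y \<omega>'))))"

text \<open>The condition says that \<open>a X + b X'\<close> has the law of \<open>sqrt (a\<^sup>2 + b\<^sup>2) X\<close> for an independent copy
  \<open>X'\<close> of \<open>X\<close>; the iterated expectation is that of \<open>\<phi> (a X + b X')\<close>, so that no space
  carrying \<open>X'\<close> has to be introduced.\<close>

definition G_normal ::
  "('w \<Rightarrow> real) set \<Rightarrow> (('w \<Rightarrow> real) \<Rightarrow> real) \<Rightarrow> ('w \<Rightarrow> real ^ 'd) \<Rightarrow> bool" where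
  "G_normal H E X \<longleftrightarrow> random_vector H X \<and>
     (\<forall>a\<ge>0. \<forall>b\<ge>0. \<forall>\<phi>\<in>C_lLip norm.
        E (\<lambda>\<omega>. E (\<lambda>\<omega>'. \<phi> (a *\<^sub>R X \<omega> + b *\<^sub>R X \<omega>'))) =
        E (\<lambda>\<omega>. \<phi> (sqrt (a\<^sup>2 + b\<^sup>2) *\<^sub>R X \<omega>)))"

definition G_function ::
  "(('w \<Rightarrow> real) \<Rightarrow> real) \<Rightarrow> ('w \<Rightarrow> real ^ 'd) \<Rightarrow> real ^ 'd ^ 'd \<Rightarrow> real" where
  "G_function E X A = E (\<lambda>\<omega>. 1 / 2 * ((A *v X \<omega>) \<bullet> X \<omega>))"

text \<open>The value at \<open>\<phi> (X)\<close> of the continuous extension of \<open>E\<close> to the completion of \<open>H\<close> under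
  \<open>E \<bar>\<cdot>\<bar>\<close>. For a random vector \<open>X\<close> and continuous \<open>\<phi>\<close> of linear growth, approximating
  sequences \<open>f\<close>, \<open>g\<close> exist (with \<open>g k\<close> a multiple of \<open>(1 + norm x ^ 2) / (k + 1)\<close>) and all of
  them give the same limit, since \<open>\<bar>f k - f' k\<bar> \<le> g k + g' k\<close>.\<close>

definition ext_expectation ::
  "(('w \<Rightarrow> real) \<Rightarrow> real) \<Rightarrow> (real ^ 'd \<Rightarrow> real) \<Rightarrow> ('w \<Rightarrow> real ^ 'd) \<Rightarrow> real" where
  "ext_expectation E \<phi> X = (THE l. \<exists>f g :: nat \<Rightarrow> real ^ 'd \<Rightarrow> real.
     (\<forall>k. f k \<in> C_lLip norm \<and> g k \<in> C_lLip norm \<and> (\<forall>x. \<bar>\<phi> x - f k x\<bar> \<le> g k x)) \<and>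
     (\<lambda>k. E (\<lambda>\<omega>. g k (X \<omega>))) \<longlonglongrightarrow> 0 \<and>
     (\<lambda>k. E (\<lambda>\<omega>. f k (X \<omega>))) \<longlonglongrightarrow> l)"

end

theory Submission
  imports Defs
begin

text \<open>
  Write \<open>T u x = E [u (x + s X\<^sub>1)]\<close> and \<open>Q u x = E' [u (x + s Z)]\<close> with \<open>s = 1 / sqrt n\<close>. Independence gives
  \<open>E [u (s (X\<^sub>1 + \<dots> + X\<^sub>n))] = T\<^sup>n u 0\<close>, and \<open>G\<close>-normality gives \<open>Q\<^sup>n u 0 = E' [u (Z)]\<close>. On smooth \<open>v\<close>
  both operators equal \<open>v + s\<^sup>2 G (D\<^sup>2 v)\<close> up to \<open>O (s\<^sup>3)\<close>. Regularity of the \<open>G\<close>-heat equation is not needed to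
  compare \<open>T\<^sup>n u\<close> with \<open>Q\<^sup>n u\<close>: as \<open>T\<close> is sublinear and commutes with translations, Jensen's inequality
  \<open>T (\<rho> * u) \<le> \<rho> * T u\<close> holds for a mollifier \<open>\<rho>\<close>, so \<open>\<rho> * T\<^sup>k u\<close> is a smooth supersolution of the scheme
  \<open>T\<close> and hence, up to \<open>O (s\<^sup>3)\<close>, of the scheme \<open>Q\<close>. This bounds \<open>Q\<^sup>n u\<close> by \<open>T\<^sup>n u\<close> up to small errors, and the
  argument is symmetric in \<open>T\<close> and \<open>Q\<close>.
\<close>

section \<open>Locally Lipschitz functions and one-step operators\<close>

text \<open>The obstacle is uniformity in the number of steps: \<open>T\<close> need not improve
  regularity, so no smoothness of the iterates is available that would hold uniformly in their
  number. What does survive every step is the bound \<open>M\<close> and the Lipschitz constant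
  \<open>l\<close>. Mollifying at a fixed scale \<open>a\<close> turns \<open>M\<close> into a cubic
  Taylor remainder whose constant \<open>L\<close> depends only on \<open>M\<close>,
  \<open>a\<close> and the dimension, while \<open>l\<close> limits the cost of mollification to
  \<open>l * a\<close>, paid once at the start and once at the end and not at each step. The
  consistency errors add up to \<open>n * O (L * s ^ 3) = O (L / sqrt n)\<close>; hence
  \<open>a\<close> is chosen before \<open>n\<close>. The constant in \<open>O (s ^ 3)\<close>
  involves third absolute moments, which are finite because the cube of the norm is locally
  Lipschitz. Continuous functions of linear growth are reached by approximation with a quadratic
  weight, since the second moments of the normalised sums are bounded in \<open>n\<close>.\<close>

definition bounded_lipschitz :: "real \<Rightarrow> real \<Rightarrow> ('a::real_normed_vector \<Rightarrow> real) set" where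
  "bounded_lipschitz M l =
     {u. (\<forall>x. \<bar>u x\<bar> \<le> M) \<and> (\<forall>x y. \<bar>u x - u y\<bar> \<le> l * norm (x - y))}"

lemma bounded_lipschitzI:
  assumes "\<And>x. \<bar>u x\<bar> \<le> M" and "\<And>x y. \<bar>u x - u y\<bar> \<le> l * norm (x - y)"
  shows "u \<in> bounded_lipschitz M l"
  using assms by (simp add: bounded_lipschitz_def)

lemma bounded_lipschitzD:
  assumes "u \<in> bounded_lipschitz M l"
  shows "\<bar>u x\<bar> \<le> M" and "\<bar>u x - u y\<bar> \<le> l * norm (x - y)"
  using assms by (simp_all add: bounded_lipschitz_def)

text \<open>The index type is nonempty, so a vector of norm 1 exists; comparing it with 0 forces the
  sign of \<open>l\<close>.\<close>

lemma lipschitz_nonneg: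
  fixes u :: "real ^ 'd \<Rightarrow> real"
  assumes "u \<in> bounded_lipschitz M l"
  shows "0 \<le> l"
proof -
  have "0 \<le> l * norm (axis undefined 1 - 0 :: real ^ 'd)"
    using bounded_lipschitzD(2)[OF assms] abs_ge_zero by (meson order_trans)
  then show ?thesis by (simp add: zero_le_mult_iff)
qed

lemma bounded_lipschitz_shift:
  assumes "u \<in> bounded_lipschitz M l"
  shows "(\<lambda>y. u (x + y)) \<in> bounded_lipschitz M l"
  using bounded_lipschitzD[OF assms]
  by (intro bounded_lipschitzI) (metis, metis add_diff_cancel_left)

lemma continuous_bounded_lipschitz:
  fixes u :: "'a::real_normed_vector \<Rightarrow> real"
  assumes "u \<in> bounded_lipschitz M l"
  shows "continuous_on UNIV u"
proof -
  have "\<bar>l\<bar>-lipschitz_on UNIV u"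
  proof (rule lipschitz_onI)
    fix x y :: 'a
    have "l * norm (x - y) \<le> \<bar>l\<bar> * norm (x - y)" by (intro mult_right_mono) auto
    then show "dist (u x) (u y) \<le> \<bar>l\<bar> * dist x y"
      using bounded_lipschitzD(2)[OF assms, of x y] by (simp add: dist_norm)
  qed simp
  then show ?thesis by (rule lipschitz_on_continuous_on)
qed

lemma C_lLipI_lipschitz:
  fixes N :: "'a::minus \<Rightarrow> real"
  assumes "\<And>x y. \<bar>\<phi> x - \<phi> y\<bar> \<le> l * N (x - y)" and "\<And>x. 0 \<le> N x"
  shows "\<phi> \<in> C_lLip N"
proof -
  \<comment> \<open>Exponent 0 suffices; \<open>\<bar>l\<bar> + 1\<close> is strictly positive
    whatever the sign of \<open>l\<close>.\<close>
  have "\<bar>\<phi> x - \<phi> y\<bar> \<le> (\<bar>l\<bar> + 1) * (1 + N x ^ 0 + N y ^ 0) * N (x - y)" for x y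
  proof -
    have "l * N (x - y) \<le> ((\<bar>l\<bar> + 1) * (1 + N x ^ 0 + N y ^ 0)) * N (x - y)"
      using assms(2) by (intro mult_right_mono) auto
    then show ?thesis using assms(1)[of x y] by linarith
  qed
  moreover have "\<bar>l\<bar> + 1 > 0" by simp
  ultimately show ?thesis unfolding C_lLip_def by blast
qed

lemma bounded_lipschitz_C_lLip:
  assumes "u \<in> bounded_lipschitz M l"
  shows "u \<in> C_lLip norm"
  using bounded_lipschitzD(2)[OF assms] by (rule C_lLipI_lipschitz) simp

text \<open>Composition with a bounded linear map, phrased through seminorms only, because tuples
  live in a function type without a norm. It serves the passage from tuples to vectors and the
  summation map on pairs.\<close>

lemma C_lLip_comp_le:
  assumes "\<psi> \<in> C_lLip N" and "0 \<le> c"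
    and "\<And>x. N (f x) \<le> c * N' x" and "\<And>x y. f x - f y = f (x - y)"
    and "\<And>x. 0 \<le> N x" and "\<And>x. 0 \<le> N' x"
  shows "(\<lambda>x. \<psi> (f x)) \<in> C_lLip N'"
proof -
  obtain C m where C: "C > 0" and
    b: "\<And>x y. \<bar>\<psi> x - \<psi> y\<bar> \<le> C * (1 + N x ^ m + N y ^ m) * N (x - y)"
    using assms(1) unfolding C_lLip_def by blast
  \<comment> \<open>The factor \<open>1 + c ^ m\<close> absorbs both the constant 1 and the powers
    of \<open>c * N'\<close>; \<open>1 + c\<close> keeps \<open>D\<close> positive even if
    \<open>c = 0\<close>.\<close>
  define D where "D = C * (1 + c ^ m) * (1 + c)"
  have D: "D > 0" using C assms(2) by (simp add: D_def add_pos_nonneg)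
  have "\<bar>\<psi> (f x) - \<psi> (f y)\<bar> \<le> D * (1 + N' x ^ m + N' y ^ m) * N' (x - y)" for x y
  proof -
    have p: "N (f z) ^ m \<le> (1 + c ^ m) * N' z ^ m" for z
    proof -
      have "N (f z) ^ m \<le> (c * N' z) ^ m" by (intro power_mono assms)
      also have "\<dots> \<le> (1 + c ^ m) * N' z ^ m"
        using assms(6)[of z] by (simp add: power_mult_distrib distrib_right)
      finally show ?thesis .
    qed
    have "1 + N (f x) ^ m + N (f y) ^ m \<le> (1 + c ^ m) * (1 + N' x ^ m + N' y ^ m)"
      using p[of x] p[of y] zero_le_power[OF assms(2), of m] by (simp add: algebra_simps)
    moreover have "N (f x - f y) \<le> (1 + c) * N' (x - y)"
      using assms(3)[of "x - y"] assms(4)[of x y] assms(6)[of "x - y"]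
      by (simp add: distrib_right)
    ultimately have "C * (1 + N (f x) ^ m + N (f y) ^ m) * N (f x - f y) \<le>
        C * ((1 + c ^ m) * (1 + N' x ^ m + N' y ^ m)) * ((1 + c) * N' (x - y))"
      using C assms(2,5,6) by (intro mult_mono mult_left_mono) (auto intro!: mult_nonneg_nonneg add_nonneg_nonneg)
    then show ?thesis using b[of "f x" "f y"] by (simp add: D_def mult_ac)
  qed
  then show ?thesis using D unfolding C_lLip_def by blast
qed

lemma norm_sq_C_lLip: "(\<lambda>x::'a::real_normed_vector. (norm x)\<^sup>2) \<in> C_lLip norm"
proof -
  have "\<bar>(norm x)\<^sup>2 - (norm y)\<^sup>2\<bar> \<le> 1 * (1 + norm x ^ 1 + norm y ^ 1) * norm (x - y)" for x y :: 'a
  proof -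
    have "\<bar>(norm x)\<^sup>2 - (norm y)\<^sup>2\<bar> = (norm x + norm y) * \<bar>norm x - norm y\<bar>"
      by (simp add: power2_eq_square square_diff_square_factored abs_mult)
    also have "\<dots> \<le> (1 + norm x + norm y) * norm (x - y)"
      by (intro mult_mono norm_triangle_ineq3) auto
    finally show ?thesis by simp
  qed
  then show ?thesis unfolding C_lLip_def using zero_less_one by blast
qed

lemma norm_cube_C_lLip: "(\<lambda>x::'a::real_normed_vector. norm x ^ 3) \<in> C_lLip norm"
proof -
  have "\<bar>norm x ^ 3 - norm y ^ 3\<bar> \<le> 2 * (1 + norm x ^ 2 + norm y ^ 2) * norm (x - y)" for x y :: 'a
  proof -
    have "norm x ^ 3 - norm y ^ 3 = ((norm x)\<^sup>2 + norm x * norm y + (norm y)\<^sup>2) * (norm x - norm y)"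
      by algebra
    then have "\<bar>norm x ^ 3 - norm y ^ 3\<bar> =
        ((norm x)\<^sup>2 + norm x * norm y + (norm y)\<^sup>2) * \<bar>norm x - norm y\<bar>"
      by (simp add: abs_mult)
    also have "\<dots> \<le> (2 * (1 + norm x ^ 2 + norm y ^ 2)) * norm (x - y)"
    proof (intro mult_mono norm_triangle_ineq3)
      have "norm x * norm y \<le> 2 * norm x * norm y" by simp
      also have "\<dots> \<le> (norm x)\<^sup>2 + (norm y)\<^sup>2" by (rule sum_squares_bound)
      finally show "(norm x)\<^sup>2 + norm x * norm y + (norm y)\<^sup>2 \<le> 2 * (1 + norm x ^ 2 + norm y ^ 2)"
        by simp
    qed auto
    finally show ?thesis by simp
  qed
  then show ?thesis unfolding C_lLip_def using zero_less_numeral by blast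
qed

lemma quadratic_form_C_lLip: "(\<lambda>x::real ^ 'd. (A *v x) \<bullet> x) \<in> C_lLip norm"
proof -
  obtain K where K: "K > 0" "\<And>x. norm (A *v x) \<le> norm x * K"
    using bounded_linear.pos_bounded[OF matrix_vector_mul_bounded_linear[of A]] by auto
  have "\<bar>(A *v x) \<bullet> x - (A *v y) \<bullet> y\<bar> \<le> K * (1 + norm x ^ 1 + norm y ^ 1) * norm (x - y)"
    for x y :: "real ^ 'd"
  proof -
    have "(A *v x) \<bullet> x - (A *v y) \<bullet> y = (A *v (x - y)) \<bullet> x + (A *v y) \<bullet> (x - y)"
      by (simp add: matrix_vector_mult_diff_distrib inner_diff_left inner_diff_right)
    also have "\<bar>\<dots>\<bar> \<le> norm (A *v (x - y)) * norm x + norm (A *v y) * norm (x - y)"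
      using Cauchy_Schwarz_ineq2[of "A *v (x - y)" x] Cauchy_Schwarz_ineq2[of "A *v y" "x - y"]
      by linarith
    also have "\<dots> \<le> (norm (x - y) * K) * norm x + (norm y * K) * norm (x - y)"
      by (intro add_mono mult_right_mono K) auto
    also have "\<dots> \<le> K * (1 + norm x ^ 1 + norm y ^ 1) * norm (x - y)"
      using K(1) by (simp add: algebra_simps)
    finally show ?thesis .
  qed
  then show ?thesis unfolding C_lLip_def using K(1) by blast
qed

lemma inner_C_lLip: "(\<lambda>x::'a::real_inner. p \<bullet> x) \<in> C_lLip norm"
proof (rule C_lLipI_lipschitz)
  show "\<bar>p \<bullet> x - p \<bullet> y\<bar> \<le> norm p * norm (x - y)" for x y
    using Cauchy_Schwarz_ineq2[of p "x - y"] by (simp add: inner_diff_right)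
qed simp

text \<open>A substitute for a bound on third derivatives: \<open>p\<close> and \<open>A\<close>
  stand for gradient and Hessian at \<open>x\<close>. The estimate covers all \<open>\<xi>\<close>,
  as the increments of a scheme may be unbounded, and one \<open>L\<close> serves all
  \<open>x\<close>. Symmetry of \<open>A\<close> is recorded because the two functions
  \<open>G\<close> are compared on symmetric matrices.\<close>

definition second_order_expansion ::
  "real \<Rightarrow> (real ^ 'd \<Rightarrow> real) \<Rightarrow> bool" where
  "second_order_expansion L v \<longleftrightarrow> (\<forall>x. \<exists>p A. transpose A = A \<and>
     (\<forall>\<xi>. \<bar>v (x + \<xi>) - v x - p \<bullet> \<xi> - 1 / 2 * ((A *v \<xi>) \<bullet> \<xi>)\<bar> \<le> L * norm \<xi> ^ 3))"

definition step_op :: "(('w \<Rightarrow> real) \<Rightarrow> real) \<Rightarrow> ('w \<Rightarrow> 'a::plus) \<Rightarrow> ('a \<Rightarrow> real) \<Rightarrow> 'a \<Rightarrow> real" where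
  "step_op E Y u x = E (\<lambda>\<omega>. u (x + Y \<omega>))"

section \<open>Calculus of a sublinear expectation and of its one-step operator\<close>

context sublinear_expectation_space
begin

lemma neg_mem: "X \<in> H \<Longrightarrow> (\<lambda>\<omega>. - X \<omega>) \<in> H"
  using scale_mem[of X "-1"] by simp

lemma sum_mem: "finite I \<Longrightarrow> (\<And>i. i \<in> I \<Longrightarrow> X i \<in> H) \<Longrightarrow> (\<lambda>\<omega>. \<Sum>i\<in>I. X i \<omega>) \<in> H"
proof (induction I rule: finite_induct)
  case empty
  then show ?case using const_mem[of 0] by simp
next
  case (insert i I)
  then show ?case using add_mem[of "X i" "\<lambda>\<omega>. \<Sum>i\<in>I. X i \<omega>"] by simp
qed

lemma expectation_sum_le:
  "finite I \<Longrightarrow> (\<And>i. i \<in> I \<Longrightarrow> X i \<in> H) \<Longrightarrow> E (\<lambda>\<omega>. \<Sum>i\<in>I. X i \<omega>) \<le> (\<Sum>i\<in>I. E (X i))"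
proof (induction I rule: finite_induct)
  case empty
  then show ?case using const[of 0] by simp
next
  case (insert i I)
  then show ?case
    using subadd[of "X i" "\<lambda>\<omega>. \<Sum>i\<in>I. X i \<omega>"] sum_mem[of I X] by simp
qed

text \<open>A summand without mean uncertainty drops out although \<open>E\<close> is only
  subadditive: subadditivity is used for \<open>U + V\<close> and again for
  \<open>V = - U + (U + V)\<close>.\<close>

lemma expectation_add_null:
  assumes "U \<in> H" "V \<in> H" "E U \<le> 0" "E (\<lambda>\<omega>. - U \<omega>) \<le> 0"
  shows "E (\<lambda>\<omega>. U \<omega> + V \<omega>) = E V"
proof (rule antisym)
  show "E (\<lambda>\<omega>. U \<omega> + V \<omega>) \<le> E V" using subadd[OF assms(1,2)] assms(3) by simp
  have "E (\<lambda>\<omega>. - U \<omega> + (U \<omega> + V \<omega>)) \<le> E (\<lambda>\<omega>. - U \<omega>) + E (\<lambda>\<omega>. U \<omega> + V \<omega>)"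
    by (intro subadd neg_mem add_mem assms)
  then show "E V \<le> E (\<lambda>\<omega>. U \<omega> + V \<omega>)" using assms(4) by simp
qed

lemma expectation_add_const:
  assumes "X \<in> H"
  shows "E (\<lambda>\<omega>. X \<omega> + c) = E X + c"
proof (rule antisym)
  show "E (\<lambda>\<omega>. X \<omega> + c) \<le> E X + c"
    using subadd[OF assms const_mem[of c]] const[of c] by simp
  have "E (\<lambda>\<omega>. (X \<omega> + c) + (- c)) \<le> E (\<lambda>\<omega>. X \<omega> + c) + E (\<lambda>\<omega>. - c)"
    by (intro subadd add_mem const_mem assms)
  then show "E X + c \<le> E (\<lambda>\<omega>. X \<omega> + c)" using const[of "- c"] by simp
qed

lemma expectation_le_add:
  assumes "X \<in> H" "Y \<in> H" "\<And>\<omega>. X \<omega> \<le> Y \<omega> + c"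
  shows "E X \<le> E Y + c"
proof -
  have "E X \<le> E (\<lambda>\<omega>. Y \<omega> + c)" by (intro mono add_mem const_mem assms)
  then show ?thesis using expectation_add_const[OF assms(2)] by simp
qed

lemma expectation_diff_le:
  assumes "X \<in> H" "Y \<in> H" "W \<in> H" "\<And>\<omega>. \<bar>X \<omega> - Y \<omega>\<bar> \<le> W \<omega>"
  shows "\<bar>E X - E Y\<bar> \<le> E W"
proof -
  have "X \<omega> \<le> Y \<omega> + W \<omega>" "Y \<omega> \<le> X \<omega> + W \<omega>" for \<omega> using assms(4)[of \<omega>] by auto
  then have "E X \<le> E (\<lambda>\<omega>. Y \<omega> + W \<omega>)" "E Y \<le> E (\<lambda>\<omega>. X \<omega> + W \<omega>)"
    by (simp_all add: mono add_mem assms)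
  then show ?thesis using subadd[OF assms(1,3)] subadd[OF assms(2,3)] by linarith
qed

text \<open>The closure axiom speaks of tuples indexed by an initial segment of \<open>nat\<close>.
  An enumeration \<open>h\<close> of the coordinates identifies these with vectors and preserves the
  Euclidean norm exactly.\<close>

lemma comp_vector_mem:
  fixes Y :: "'w \<Rightarrow> real ^ 'd"
  assumes "random_vector H Y" "\<phi> \<in> C_lLip norm"
  shows "(\<lambda>\<omega>. \<phi> (Y \<omega>)) \<in> H"
proof -
  define n where "n = CARD('d)"
  obtain h :: "'d \<Rightarrow> nat" where h: "bij_betw h UNIV {..<n}"
    using ex_bij_betw_finite_nat[OF finite[of "UNIV :: 'd set"]]
    by (auto simp: n_def atLeast0LessThan)
  define f :: "(nat \<Rightarrow> real) \<Rightarrow> real ^ 'd" where "f x = (\<chi> k. x (h k))" for x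
  have N: "norm (f x) = tuple_norm {..<n} x" for x
    using h by (simp add: f_def norm_vec_def tuple_norm_def L2_set_def
        sum.reindex_bij_betw[OF h, of "\<lambda>j. (x j)\<^sup>2"])
  have "(\<lambda>x. \<phi> (f x)) \<in> C_lLip (tuple_norm {..<n})"
  proof (rule C_lLip_comp_le[OF assms(2), where c = 1])
    show "norm (f x) \<le> 1 * tuple_norm {..<n} x" for x by (simp add: N)
    show "f x - f y = f (x - y)" for x y by (simp add: f_def vec_eq_iff)
    show "0 \<le> tuple_norm {..<n} x" for x :: "nat \<Rightarrow> real"
      by (simp add: tuple_norm_def L2_set_nonneg)
  qed auto
  then have "(\<lambda>\<omega>. \<phi> (f (\<lambda>i. Y \<omega> $ (inv h i)))) \<in> H"
    using assms(1) by (intro comp_mem[where Xs = "\<lambda>i \<omega>. Y \<omega> $ inv h i" and \<phi> = "\<lambda>x. \<phi> (f x)"])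
      (auto simp: random_vector_def)
  moreover have "f (\<lambda>i. Y \<omega> $ (inv h i)) = Y \<omega>" for \<omega>
    using h by (simp add: f_def vec_eq_iff bij_betw_def)
  ultimately show ?thesis by simp
qed

lemma random_vector_scale: "random_vector H X \<Longrightarrow> random_vector H (\<lambda>\<omega>. c *\<^sub>R X \<omega>)"
  by (simp add: random_vector_def scale_mem)

lemma random_vector_sum:
  "finite I \<Longrightarrow> (\<And>i. i \<in> I \<Longrightarrow> random_vector H (X i)) \<Longrightarrow> random_vector H (\<lambda>\<omega>. \<Sum>i\<in>I. X i \<omega>)"
  by (simp add: random_vector_def sum_mem)

lemma bounded_lipschitz_mem:
  assumes "random_vector H Y" "u \<in> bounded_lipschitz M l"
  shows "(\<lambda>\<omega>. u (x + Y \<omega>)) \<in> H"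
  using comp_vector_mem[OF assms(1)
      bounded_lipschitz_C_lLip[OF bounded_lipschitz_shift[OF assms(2), of x]]] .

text \<open>Constants are preserved and translations commute with the step, so neither the bound nor
  the Lipschitz constant deteriorates under iteration.\<close>

lemma step_op_bounded_lipschitz:
  fixes u :: "real ^ 'd \<Rightarrow> real"
  assumes Y: "random_vector H Y" and u: "u \<in> bounded_lipschitz M l"
  shows "step_op E Y u \<in> bounded_lipschitz M l"
proof (rule bounded_lipschitzI)
  fix x y
  have b: "\<bar>u z\<bar> \<le> M" for z by (rule bounded_lipschitzD(1)[OF u])
  note m = bounded_lipschitz_mem[OF Y u]
  have "\<bar>E (\<lambda>\<omega>. u (x + Y \<omega>)) - E (\<lambda>\<omega>. 0)\<bar> \<le> E (\<lambda>\<omega>. M)"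
    using b by (intro expectation_diff_le m const_mem) auto
  then show "\<bar>step_op E Y u x\<bar> \<le> M" by (simp add: step_op_def const)
  have "\<bar>u (x + Y \<omega>) - u (y + Y \<omega>)\<bar> \<le> l * norm (x - y)" for \<omega>
    using bounded_lipschitzD(2)[OF u, of "x + Y \<omega>" "y + Y \<omega>"] by simp
  then have "\<bar>E (\<lambda>\<omega>. u (x + Y \<omega>)) - E (\<lambda>\<omega>. u (y + Y \<omega>))\<bar> \<le> E (\<lambda>\<omega>. l * norm (x - y))"
    by (intro expectation_diff_le m const_mem)
  then show "\<bar>step_op E Y u x - step_op E Y u y\<bar> \<le> l * norm (x - y)"
    by (simp add: step_op_def const)
qed

lemma step_op_funpow_bounded_lipschitz:
  fixes u :: "real ^ 'd \<Rightarrow> real"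
  assumes "random_vector H Y" "u \<in> bounded_lipschitz M l"
  shows "(step_op E Y ^^ n) u \<in> bounded_lipschitz M l"
  by (induction n) (simp_all add: assms step_op_bounded_lipschitz)

lemma step_op_le_add:
  fixes u v :: "real ^ 'd \<Rightarrow> real"
  assumes "random_vector H Y" "u \<in> bounded_lipschitz M l" "v \<in> bounded_lipschitz M' l'"
    and "\<And>x. u x \<le> v x + c"
  shows "step_op E Y u x \<le> step_op E Y v x + c"
  unfolding step_op_def
  by (intro expectation_le_add bounded_lipschitz_mem[OF assms(1,2)]
      bounded_lipschitz_mem[OF assms(1,3)] assms(4))

lemma step_op_funpow_le_add:
  fixes u v :: "real ^ 'd \<Rightarrow> real"
  assumes "random_vector H Y" "u \<in> bounded_lipschitz M l" "v \<in> bounded_lipschitz M' l'"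
    and "\<And>x. u x \<le> v x + c"
  shows "(step_op E Y ^^ n) u x \<le> (step_op E Y ^^ n) v x + c"
proof (induction n arbitrary: x)
  case 0
  then show ?case by (simp add: assms(4))
next
  case (Suc n)
  show ?case
    using step_op_le_add[OF assms(1) step_op_funpow_bounded_lipschitz[OF assms(1,2)]
        step_op_funpow_bounded_lipschitz[OF assms(1,3)] Suc] by simp
qed

text \<open>Positive homogeneity handles coordinates with \<open>p $ k \<ge> 0\<close>; the others
  need the mean of the negated coordinate. Subadditivity then gives one inequality, and
  \<open>- p\<close> in place of \<open>p\<close> gives the companion bound.\<close>

lemma expectation_inner_le_0:
  fixes Y :: "'w \<Rightarrow> real ^ 'd"
  assumes Y: "random_vector H Y"
    and mean: "\<And>k. E (\<lambda>\<omega>. Y \<omega> $ k) = 0" "\<And>k. E (\<lambda>\<omega>. - (Y \<omega> $ k)) = 0"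
  shows "E (\<lambda>\<omega>. p \<bullet> Y \<omega>) \<le> 0"
proof -
  have m: "(\<lambda>\<omega>. Y \<omega> $ k) \<in> H" for k using Y by (simp add: random_vector_def)
  have z: "E (\<lambda>\<omega>. p $ k * Y \<omega> $ k) = 0" for k
  proof (cases "p $ k \<ge> 0")
    case True
    then show ?thesis using pos_hom[OF m[of k]] mean(1) by simp
  next
    case False
    then show ?thesis using pos_hom[OF neg_mem[OF m[of k]], of "- p $ k"] mean(2) by simp
  qed
  have "E (\<lambda>\<omega>. \<Sum>k\<in>UNIV. p $ k * Y \<omega> $ k) \<le> (\<Sum>k\<in>UNIV. E (\<lambda>\<omega>. p $ k * Y \<omega> $ k))"
    by (intro expectation_sum_le scale_mem m) simp
  then show ?thesis by (simp add: z inner_vec_def)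
qed

lemma expectation_add_inner:
  fixes Y :: "'w \<Rightarrow> real ^ 'd"
  assumes Y: "random_vector H Y"
    and mean: "\<And>k. E (\<lambda>\<omega>. Y \<omega> $ k) = 0" "\<And>k. E (\<lambda>\<omega>. - (Y \<omega> $ k)) = 0"
    and V: "V \<in> H"
  shows "E (\<lambda>\<omega>. p \<bullet> Y \<omega> + V \<omega>) = E V"
proof (rule expectation_add_null)
  show "(\<lambda>\<omega>. p \<bullet> Y \<omega>) \<in> H" by (rule comp_vector_mem[OF Y inner_C_lLip])
  show "E (\<lambda>\<omega>. p \<bullet> Y \<omega>) \<le> 0" by (rule expectation_inner_le_0[OF Y mean])
  show "E (\<lambda>\<omega>. - (p \<bullet> Y \<omega>)) \<le> 0"
    using expectation_inner_le_0[OF Y mean, of "- p"] by simp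
qed (rule V)

text \<open>The linear term has no mean uncertainty and can be removed from under \<open>E\<close>,
  the constant can be pulled out, and what remains is a single quadratic form, whose expectation is
  \<open>G_function E Y A\<close>. The cubic remainder is paid for by the third absolute
  moment.\<close>

lemma step_op_expansion:
  fixes Y :: "'w \<Rightarrow> real ^ 'd"
  assumes Y: "random_vector H Y"
    and mean: "\<And>k. E (\<lambda>\<omega>. Y \<omega> $ k) = 0" "\<And>k. E (\<lambda>\<omega>. - (Y \<omega> $ k)) = 0"
    and v: "v \<in> bounded_lipschitz M l"
    and A: "\<And>\<xi>. \<bar>v (x + \<xi>) - v x - p \<bullet> \<xi> - 1 / 2 * ((A *v \<xi>) \<bullet> \<xi>)\<bar> \<le> L * norm \<xi> ^ 3"
    and s: "0 \<le> s" and L: "0 \<le> L"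
  shows "\<bar>step_op E (\<lambda>\<omega>. s *\<^sub>R Y \<omega>) v x - (v x + s\<^sup>2 * G_function E Y A)\<bar>
           \<le> L * s ^ 3 * E (\<lambda>\<omega>. norm (Y \<omega>) ^ 3)"
proof -
  define Q where "Q \<omega> = 1 / 2 * ((A *v Y \<omega>) \<bullet> Y \<omega>)" for \<omega>
  define R where "R \<omega> = norm (Y \<omega>) ^ 3" for \<omega>
  have Q: "Q \<in> H" unfolding Q_def
    by (intro scale_mem comp_vector_mem[OF Y quadratic_form_C_lLip])
  have R: "R \<in> H" unfolding R_def by (rule comp_vector_mem[OF Y norm_cube_C_lLip])
  have sm: "(\<lambda>\<omega>. s\<^sup>2 * Q \<omega> + v x) \<in> H" by (intro add_mem scale_mem const_mem Q)
  have pm: "(\<lambda>\<omega>. (s *\<^sub>R p) \<bullet> Y \<omega> + (s\<^sup>2 * Q \<omega> + v x)) \<in> H"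
    using comp_vector_mem[OF Y inner_C_lLip] sm by (rule add_mem)
  have "E (\<lambda>\<omega>. (s *\<^sub>R p) \<bullet> Y \<omega> + (s\<^sup>2 * Q \<omega> + v x)) = E (\<lambda>\<omega>. s\<^sup>2 * Q \<omega> + v x)"
    by (rule expectation_add_inner[OF Y mean sm])
  also have "\<dots> = s\<^sup>2 * E Q + v x"
    using expectation_add_const[OF scale_mem[OF Q]] pos_hom[OF Q] by simp
  finally have eq: "E (\<lambda>\<omega>. (s *\<^sub>R p) \<bullet> Y \<omega> + (s\<^sup>2 * Q \<omega> + v x)) = s\<^sup>2 * E Q + v x" .
  have "\<bar>v (x + s *\<^sub>R Y \<omega>) - ((s *\<^sub>R p) \<bullet> Y \<omega> + (s\<^sup>2 * Q \<omega> + v x))\<bar> \<le> L * s ^ 3 * R \<omega>" for \<omega>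
    using A[of "s *\<^sub>R Y \<omega>"] s
    by (simp add: Q_def R_def matrix_vector_mult_scaleR power2_eq_square algebra_simps
        power_mult_distrib)
  then have "\<bar>E (\<lambda>\<omega>. v (x + s *\<^sub>R Y \<omega>)) - E (\<lambda>\<omega>. (s *\<^sub>R p) \<bullet> Y \<omega> + (s\<^sup>2 * Q \<omega> + v x))\<bar>
      \<le> E (\<lambda>\<omega>. L * s ^ 3 * R \<omega>)"
    by (intro expectation_diff_le pm scale_mem R
        bounded_lipschitz_mem[OF random_vector_scale[OF Y] v])
  moreover have "E (\<lambda>\<omega>. L * s ^ 3 * R \<omega>) = L * s ^ 3 * E R"
    using s L by (intro pos_hom R) simp
  ultimately show ?thesis
    unfolding eq by (simp add: step_op_def G_function_def Q_def[abs_def] R_def[abs_def] add.commute)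
qed

end

section \<open>Mollification\<close>

text \<open>The fourth power of a truncated paraboloid is compactly supported and three times
  continuously differentiable, and its expansion with cubic remainder follows from polynomial
  identities. It is not normalised; averages divide by its integral.\<close>

definition bump :: "real \<Rightarrow> 'a::euclidean_space \<Rightarrow> real" where
  "bump a y = (max 0 (a\<^sup>2 - (norm y)\<^sup>2)) ^ 4"

text \<open>Without truncation the binomial formula leaves exactly
  \<open>4 * s * d ^ 3 + d ^ 4\<close>. If \<open>s\<close> and \<open>s + d\<close> have opposite
  signs, then \<open>\<bar>s + d\<bar> \<le> \<bar>d\<bar>\<close>, so the term affected by the
  truncation is at most \<open>d ^ 4\<close>.\<close>

lemma max_power4_expansion:
  fixes s d :: real
  shows "\<bar>(max 0 (s + d)) ^ 4 - (max 0 s) ^ 4 - 4 * (max 0 s) ^ 3 * d - 6 * (max 0 s)\<^sup>2 * d\<^sup>2\<bar>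
           \<le> 4 * max 0 s * \<bar>d\<bar> ^ 3 + 2 * d ^ 4"
proof -
  have 4: "0 \<le> d ^ 4" by simp
  show ?thesis
  proof (cases "s \<ge> 0")
    case True
    have e: "(s + d) ^ 4 - s ^ 4 - 4 * s ^ 3 * d - 6 * s\<^sup>2 * d\<^sup>2 = 4 * s * d ^ 3 + d ^ 4"
      by algebra
    have "\<bar>4 * s * d ^ 3\<bar> = 4 * s * \<bar>d\<bar> ^ 3" using True by (simp add: abs_mult power_abs)
    then have b: "4 * s * d ^ 3 \<le> 4 * s * \<bar>d\<bar> ^ 3" "- (4 * s * d ^ 3) \<le> 4 * s * \<bar>d\<bar> ^ 3"
      by (metis abs_ge_self, metis abs_ge_minus_self)
    show ?thesis
    proof (cases "s + d \<ge> 0")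
      case t: True
      have m: "max 0 (s + d) = s + d" "max 0 s = s" using t True by auto
      show ?thesis unfolding m e using b 4 by (intro abs_leI) linarith+
    next
      case f: False
      have "\<bar>s + d\<bar> ^ 4 \<le> \<bar>d\<bar> ^ 4" using f True by (intro power_mono) auto
      then have p: "0 \<le> (s + d) ^ 4" "(s + d) ^ 4 \<le> d ^ 4" by (simp_all add: power_even_abs)
      have m: "max 0 (s + d) = 0" "max 0 s = s" using f True by auto
      have e': "0 ^ 4 - s ^ 4 - 4 * s ^ 3 * d - 6 * s\<^sup>2 * d\<^sup>2 = 4 * s * d ^ 3 + d ^ 4 - (s + d) ^ 4"
        using e by simp
      show ?thesis unfolding m e' using b 4 p by (intro abs_leI) linarith+
    qed
  next
    case s: False
    have "0 \<le> (max 0 (s + d)) ^ 4" by simp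
    moreover have "(max 0 (s + d)) ^ 4 \<le> \<bar>d\<bar> ^ 4" using s by (intro power_mono) auto
    ultimately have "\<bar>(max 0 (s + d)) ^ 4\<bar> \<le> d ^ 4" by (simp add: power_even_abs)
    also have "\<dots> \<le> d ^ 4 + d ^ 4" using 4 by (rule le_add_same_cancel1[THEN iffD2])
    finally have "\<bar>(max 0 (s + d)) ^ 4\<bar> \<le> 2 * d ^ 4" by simp
    then show ?thesis using s by (simp add: max_absorb1)
  qed
qed

text \<open>For small \<open>\<xi>\<close> this is the expansion of the fourth power at the
  increment of \<open>a\<^sup>2 - (norm w)\<^sup>2\<close>; for \<open>norm \<xi> > 1\<close> every
  term separately is below a multiple of \<open>norm \<xi> ^ 3\<close>. The indicators record where
  the remainder can be nonzero and make the bound integrable in \<open>w\<close>.\<close>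

lemma bump_expansion:
  fixes w \<xi> :: "'a::euclidean_space"
  assumes a: "0 < a" "a \<le> 1"
  defines "r \<equiv> max 0 (a\<^sup>2 - (norm w)\<^sup>2)"
  shows "\<bar>bump a (w + \<xi>) - bump a w + 8 * r ^ 3 * (w \<bullet> \<xi>)
            - (24 * r\<^sup>2 * (w \<bullet> \<xi>)\<^sup>2 - 4 * r ^ 3 * (norm \<xi>)\<^sup>2)\<bar>
         \<le> 1780 * norm \<xi> ^ 3 * (indicator (cball 0 a) w + indicator (cball 0 a) (w + \<xi>))"
    (is "\<bar>?R\<bar> \<le> _")
proof -
  have a2: "a\<^sup>2 \<le> 1" using a by (simp add: power_le_one)
  have out: "max 0 (a\<^sup>2 - (norm y)\<^sup>2) = 0" if "y \<notin> cball 0 a" for y :: 'a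
  proof -
    have "a\<^sup>2 \<le> (norm y)\<^sup>2" using that a by (intro power_mono) auto
    then show ?thesis by simp
  qed
  have r: "0 \<le> r" "r \<le> 1" using a2 by (auto simp: r_def intro: order_trans[OF _ a2])
  have rp: "0 \<le> r ^ k" "r ^ k \<le> 1" for k using r by (simp_all add: power_le_one)
  have bb: "0 \<le> bump a y" "bump a y \<le> 1" for y :: 'a
  proof -
    have "max 0 (a\<^sup>2 - (norm y)\<^sup>2) \<le> 1" using a2 by (auto intro: order_trans[OF _ a2])
    then show "bump a y \<le> 1" unfolding bump_def by (intro power_le_one) auto
  qed (simp add: bump_def)
  define t where "t = norm \<xi>"
  have t: "0 \<le> t" by (simp add: t_def)
  \<comment> \<open>On the ball \<open>norm w \<le> 1\<close>; off the ball a positive power of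
    \<open>r\<close> vanishes, which compensates the growth of \<open>w\<close>.\<close>
  have wr: "r ^ k * \<bar>w \<bullet> \<xi>\<bar> \<le> t" if "k > 0" for k
  proof (cases "w \<in> cball 0 a")
    case True
    have "\<bar>w \<bullet> \<xi>\<bar> \<le> norm w * t" unfolding t_def by (rule Cauchy_Schwarz_ineq2)
    also have "\<dots> \<le> 1 * t" using True a t by (intro mult_right_mono) auto
    finally have "\<bar>w \<bullet> \<xi>\<bar> \<le> t" by simp
    moreover have "r ^ k * \<bar>w \<bullet> \<xi>\<bar> \<le> 1 * \<bar>w \<bullet> \<xi>\<bar>" by (intro mult_right_mono rp) auto
    ultimately show ?thesis by linarith
  next
    case False
    then show ?thesis using out[OF False] that t by (simp add: r_def zero_power)
  qed
  have wr2: "r\<^sup>2 * (w \<bullet> \<xi>)\<^sup>2 \<le> t\<^sup>2"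
  proof -
    have "(r ^ 1 * \<bar>w \<bullet> \<xi>\<bar>)\<^sup>2 \<le> t\<^sup>2" using r by (intro power_mono wr) auto
    then show ?thesis by (simp add: power_mult_distrib)
  qed
  show ?thesis
  proof (cases "w \<in> cball 0 a \<or> w + \<xi> \<in> cball 0 a")
    case False
    then have "r = 0" "bump a w = 0" "bump a (w + \<xi>) = 0"
      using out[of w] out[of "w + \<xi>"] by (simp_all add: r_def bump_def)
    then show ?thesis by simp
  next
    case True
    have "\<bar>?R\<bar> \<le> 1780 * t ^ 3"
    proof (cases "t \<le> 1")
      case t1: True
      define d where "d = - (2 * (w \<bullet> \<xi>) + t\<^sup>2)"
      have sd: "a\<^sup>2 - (norm (w + \<xi>))\<^sup>2 = (a\<^sup>2 - (norm w)\<^sup>2) + d"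
        by (simp add: d_def t_def power2_norm_eq_inner inner_add_left inner_add_right inner_commute)
      have "norm w \<le> 2"
      proof (cases "w \<in> cball 0 a")
        case False
        then have "norm (w + \<xi>) \<le> a" using True by simp
        then show ?thesis using norm_triangle_ineq4[of "w + \<xi>" \<xi>] a t1 by (simp add: t_def)
      qed (use a in auto)
      then have "\<bar>w \<bullet> \<xi>\<bar> \<le> 2 * t"
        using Cauchy_Schwarz_ineq2[of w \<xi>] mult_right_mono[of "norm w" 2 t] t by (simp add: t_def)
      moreover have "0 \<le> t\<^sup>2" "t\<^sup>2 \<le> t"
        using t t1 by (simp_all add: power2_eq_square mult_left_le)
      \<comment> \<open>From \<open>2 * \<bar>w \<bullet> \<xi>\<bar> \<le> 4 * t\<close> and
        \<open>t\<^sup>2 \<le> t\<close>.\<close>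
      ultimately have d: "\<bar>d\<bar> \<le> 5 * t" unfolding d_def using t by linarith
      have d3: "\<bar>d\<bar> ^ 3 \<le> 125 * t ^ 3" using power_mono[OF d, of 3] by (simp add: power_mult_distrib)
      have t4: "t ^ 4 \<le> t ^ 3" using t t1 by (intro power_decreasing) auto
      have d4: "d ^ 4 \<le> 625 * t ^ 4"
        using power_mono[OF d, of 4] by (simp add: power_mult_distrib power_even_abs)
      have "\<bar>bump a (w + \<xi>) - bump a w - 4 * r ^ 3 * d - 6 * r\<^sup>2 * d\<^sup>2\<bar>
          \<le> 4 * r * \<bar>d\<bar> ^ 3 + 2 * d ^ 4"
        using max_power4_expansion[of "a\<^sup>2 - (norm w)\<^sup>2" d] by (simp add: bump_def sd r_def)
      also have "\<dots> \<le> 4 * \<bar>d\<bar> ^ 3 + 2 * d ^ 4"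
        using mult_right_mono[OF r(2), of "\<bar>d\<bar> ^ 3"] by simp
      \<comment> \<open>\<open>1750 = 4 * 125 + 2 * 625\<close>, with
        \<open>t ^ 4 \<le> t ^ 3\<close>. The two leftover terms below contribute 24 and 6, which
        gives 1780.\<close>
      finally have T: "\<bar>bump a (w + \<xi>) - bump a w - 4 * r ^ 3 * d - 6 * r\<^sup>2 * d\<^sup>2\<bar> \<le> 1750 * t ^ 3"
        using d3 d4 t4 by linarith
      \<comment> \<open>Squaring \<open>d\<close> produces, besides the Hessian term, a mixed term
        and a pure term in \<open>t\<close> of orders three and four; these go into the
        remainder.\<close>
      have "?R = (bump a (w + \<xi>) - bump a w - 4 * r ^ 3 * d - 6 * r\<^sup>2 * d\<^sup>2)
          + (24 * (r\<^sup>2 * (w \<bullet> \<xi>)) * t\<^sup>2 + 6 * r\<^sup>2 * t ^ 4)"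
        unfolding d_def t_def[symmetric] by algebra
      moreover have "\<bar>24 * (r\<^sup>2 * (w \<bullet> \<xi>)) * t\<^sup>2\<bar> \<le> 24 * t ^ 3"
      proof -
        have "\<bar>24 * (r\<^sup>2 * (w \<bullet> \<xi>)) * t\<^sup>2\<bar> = 24 * (r\<^sup>2 * \<bar>w \<bullet> \<xi>\<bar>) * t\<^sup>2"
          by (simp add: abs_mult)
        also have "\<dots> \<le> 24 * t * t\<^sup>2" using wr[of 2] by (intro mult_right_mono) auto
        finally show ?thesis by (simp add: power2_eq_square power3_eq_cube)
      qed
      moreover have "0 \<le> r\<^sup>2 * t ^ 4" "r\<^sup>2 * t ^ 4 \<le> t ^ 4"
        using rp[of 2] mult_right_mono[OF rp(2)[of 2], of "t ^ 4"] by auto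
      ultimately show ?thesis using T t4 by linarith
    next
      case False
      then have t1: "1 \<le> t" by simp
      have t3: "1 \<le> t ^ 3" "t \<le> t ^ 3" "t\<^sup>2 \<le> t ^ 3"
        using t1 power_increasing[OF _ t1, of 1 3] power_increasing[OF _ t1, of 2 3]
        by (auto simp: one_le_power)
      have "0 \<le> r ^ 3 * t\<^sup>2" "r ^ 3 * t\<^sup>2 \<le> t\<^sup>2"
        using rp[of 3] mult_right_mono[OF rp(2)[of 3], of "t\<^sup>2"] by auto
      moreover have "\<bar>8 * r ^ 3 * (w \<bullet> \<xi>)\<bar> \<le> 8 * t" using wr[of 3] rp(1)[of 3] by (simp add: abs_mult)
      moreover have "0 \<le> r\<^sup>2 * (w \<bullet> \<xi>)\<^sup>2" by simp
      ultimately show ?thesis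
        using bb[of w] bb[of "w + \<xi>"] wr2 t3 unfolding t_def[symmetric] mult.assoc by linarith
    qed
    moreover have "1 \<le> indicator (cball 0 a) w + (indicator (cball 0 a) (w + \<xi>) :: real)"
      using True by (auto simp: indicator_def)
    ultimately show ?thesis
      using mult_left_mono[of 1 "indicator (cball 0 a) w + indicator (cball 0 a) (w + \<xi>)" "1780 * t ^ 3"] t
      unfolding t_def by simp
  qed
qed

section \<open>Averages against the kernel\<close>

lemma integrable_continuous_compact_support:
  fixes f :: "'a::euclidean_space \<Rightarrow> 'b::euclidean_space"
  assumes "continuous_on UNIV f" and "\<And>z. z \<notin> cball x a \<Longrightarrow> f z = 0"
  shows "integrable lborel f"
proof -
  have "integrable lborel (\<lambda>z. indicator (cball x a) z *\<^sub>R f z)"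
    by (intro borel_integrable_compact continuous_on_subset[OF assms(1)]) auto
  moreover have "(\<lambda>z. indicator (cball x a) z *\<^sub>R f z) = f"
    using assms(2) by (auto simp: fun_eq_iff indicator_def)
  ultimately show ?thesis by simp
qed

lemma lborel_integral_reflect:
  fixes f :: "'a::euclidean_space \<Rightarrow> real"
  assumes "f \<in> borel_measurable borel"
  shows "(\<integral>y. f (x - y) \<partial>lborel) = (\<integral>z. f z \<partial>lborel)"
proof -
  have "lborel = distr lborel borel (\<lambda>y. x - y)"
    using lborel_affine[of "-1" x] by (simp add: density_1)
  then have "(\<integral>z. f z \<partial>lborel) = (\<integral>z. f z \<partial>distr lborel borel (\<lambda>y. x - y))" by simp
  also have "\<dots> = (\<integral>y. f (x - y) \<partial>lborel)" using assms by (intro integral_distr) auto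
  finally show ?thesis by simp
qed

lemma bump_nonneg: "0 \<le> bump a y"
  by (simp add: bump_def)

lemma bump_zero:
  assumes "0 < a" "y \<notin> cball 0 a"
  shows "bump a y = 0"
proof -
  have "a\<^sup>2 \<le> (norm y)\<^sup>2" using assms by (intro power_mono) auto
  then show ?thesis by (simp add: bump_def)
qed

lemma continuous_bump: "continuous_on S (bump a)"
  unfolding bump_def[abs_def] by (intro continuous_intros)

lemma integrable_bump_mult:
  fixes f :: "'a::euclidean_space \<Rightarrow> real"
  assumes "0 < a" "continuous_on UNIV f"
  shows "integrable lborel (\<lambda>y. bump a y * f y)"
  using assms
  by (intro integrable_continuous_compact_support[where x = 0 and a = a] continuous_intros continuous_bump)
    (auto simp: bump_zero)

lemma integrable_bump:
  assumes "0 < a"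
  shows "integrable lborel (bump a :: 'a::euclidean_space \<Rightarrow> real)"
  using integrable_bump_mult[OF assms, of "\<lambda>_. 1"] by simp

lemma integral_bump_pos:
  assumes "0 < a"
  shows "0 < (\<integral>y. bump a (y::'a::euclidean_space) \<partial>lborel)"
proof -
  \<comment> \<open>A lower bound of the kernel on the ball of half the radius, where
    \<open>a\<^sup>2 - (norm y)\<^sup>2 \<ge> 3 / 4 * a\<^sup>2\<close>.\<close>
  define b where "b = (3 / 4 * a\<^sup>2) ^ 4"
  have b: "b > 0" using assms by (simp add: b_def)
  have ball: "integrable lborel (indicat_real (cball (0::'a) (a / 2)))"
    using emeasure_lborel_cball_finite[of "0::'a" "a / 2"] by (intro integrable_real_indicator) auto
  have "0 < measure lborel (cball (0::'a) (a / 2))"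
    using content_cball_pos[of "a / 2" "0::'a"] assms by simp
  then have "0 < b * measure lborel (cball (0::'a) (a / 2))" using b by simp
  also have "\<dots> = (\<integral>y. b * indicator (cball (0::'a) (a / 2)) y \<partial>lborel)"
    using ball by simp
  also have "\<dots> \<le> (\<integral>y. bump a (y::'a) \<partial>lborel)"
  proof (rule integral_mono)
    show "integrable lborel (\<lambda>y. b * indicator (cball (0::'a) (a / 2)) y)"
      by (intro integrable_mult_right ball)
    show "integrable lborel (bump a :: 'a \<Rightarrow> real)"
      by (rule integrable_bump[OF assms])
    show "b * indicator (cball (0::'a) (a / 2)) y \<le> bump a y" for y :: 'a
    proof (cases "y \<in> cball 0 (a / 2)")
      case True
      then have "(norm y)\<^sup>2 \<le> (a / 2)\<^sup>2" by (intro power_mono) auto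
      then have "3 / 4 * a\<^sup>2 \<le> max 0 (a\<^sup>2 - (norm y)\<^sup>2)" by (simp add: power_divide le_max_iff_disj)
      from power_mono[OF this, of 4] show ?thesis
        using True by (simp add: bump_def b_def)
    qed (simp add: bump_nonneg)
  qed
  finally show ?thesis .
qed

definition mollify :: "real \<Rightarrow> ('a::euclidean_space \<Rightarrow> real) \<Rightarrow> 'a \<Rightarrow> real" where
  "mollify a u x = (\<integral>y. bump a y * u (x - y) \<partial>lborel) / (\<integral>y. bump a (y::'a) \<partial>lborel)"

text \<open>The bound on \<open>f\<close> is asked only on the support of the kernel: this is what
  yields the error \<open>l * a\<close> when \<open>f\<close> is an increment of a Lipschitz
  function.\<close>

lemma bump_average_le:
  fixes f :: "'a::euclidean_space \<Rightarrow> real"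
  assumes a: "0 < a" and f: "continuous_on UNIV f" and K: "\<And>y. norm y \<le> a \<Longrightarrow> \<bar>f y\<bar> \<le> K"
  shows "\<bar>(\<integral>y. bump a y * f y \<partial>lborel) / (\<integral>y. bump a (y::'a) \<partial>lborel)\<bar> \<le> K"
proof -
  have "\<bar>\<integral>y. bump a y * f y \<partial>lborel\<bar> \<le> (\<integral>y. \<bar>bump a y * f y\<bar> \<partial>lborel)"
    by (rule integral_abs_bound)
  also have "\<dots> \<le> (\<integral>y. bump a (y::'a) * K \<partial>lborel)"
  proof (rule integral_mono)
    show "integrable lborel (\<lambda>y. \<bar>bump a y * f y\<bar>)"
      by (intro integrable_abs integrable_bump_mult a f)
    show "integrable lborel (\<lambda>y::'a. bump a y * K)"
      by (intro integrable_bump_mult a continuous_intros)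
    show "\<bar>bump a y * f y\<bar> \<le> bump a y * K" for y
    proof (cases "y \<in> cball 0 a")
      case True
      then show ?thesis using K[of y] bump_nonneg[of a y] by (simp add: abs_mult mult_left_mono)
    qed (simp add: bump_zero a)
  qed
  finally show ?thesis using integral_bump_pos[OF a, where 'a = 'a] by (simp add: field_simps)
qed

lemma continuous_reflect:
  fixes u :: "'a::real_normed_vector \<Rightarrow> real"
  assumes "u \<in> bounded_lipschitz M l"
  shows "continuous_on UNIV (\<lambda>y. u (x - y))"
  by (rule continuous_on_compose2[OF continuous_bounded_lipschitz[OF assms]])
    (auto intro!: continuous_intros)

lemma mollify_bounded_lipschitz:
  fixes u :: "'a::euclidean_space \<Rightarrow> real"
  assumes a: "0 < a" and u: "u \<in> bounded_lipschitz M l"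
  shows "mollify a u \<in> bounded_lipschitz M l"
proof (rule bounded_lipschitzI)
  note c = continuous_reflect[OF u]
  show "\<bar>mollify a u x\<bar> \<le> M" for x
    unfolding mollify_def by (intro bump_average_le a c bounded_lipschitzD(1)[OF u])
  fix x y
  have "mollify a u x - mollify a u y =
      (\<integral>z. bump a z * (u (x - z) - u (y - z)) \<partial>lborel) / (\<integral>y. bump a (y::'a) \<partial>lborel)"
    unfolding mollify_def diff_divide_distrib[symmetric] right_diff_distrib
    by (subst Bochner_Integration.integral_diff) (auto intro!: integrable_bump_mult a c)
  also have "\<bar>\<dots>\<bar> \<le> l * norm (x - y)"
  proof (intro bump_average_le a continuous_on_diff c)
    show "\<bar>u (x - z) - u (y - z)\<bar> \<le> l * norm (x - y)" for z
      using bounded_lipschitzD(2)[OF u, of "x - z" "y - z"] by simp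
  qed
  finally show "\<bar>mollify a u x - mollify a u y\<bar> \<le> l * norm (x - y)" .
qed

lemma mollify_approx:
  fixes u :: "'a::euclidean_space \<Rightarrow> real"
  assumes a: "0 < a" and u: "u \<in> bounded_lipschitz M l" and l: "0 \<le> l"
  shows "\<bar>mollify a u x - u x\<bar> \<le> l * a"
proof -
  note c = continuous_reflect[OF u]
  have "u x = (\<integral>z. bump a (z::'a) * u x \<partial>lborel) / (\<integral>y. bump a (y::'a) \<partial>lborel)"
    using integral_bump_pos[OF a, where 'a = 'a]
    by simp
  then have "mollify a u x - u x =
      (\<integral>z. bump a z * u (x - z) \<partial>lborel) / (\<integral>y. bump a (y::'a) \<partial>lborel) -
      (\<integral>z. bump a (z::'a) * u x \<partial>lborel) / (\<integral>y. bump a (y::'a) \<partial>lborel)"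
    unfolding mollify_def by linarith
  also have "\<dots> = (\<integral>z. bump a z * (u (x - z) - u x) \<partial>lborel) / (\<integral>y. bump a (y::'a) \<partial>lborel)"
    unfolding diff_divide_distrib[symmetric] right_diff_distrib
    by (subst Bochner_Integration.integral_diff)
      (simp_all add: integrable_bump[OF a] integrable_bump_mult[OF a c])
  also have "\<bar>\<dots>\<bar> \<le> l * a"
  proof (intro bump_average_le a continuous_on_diff c continuous_on_const)
    show "\<bar>u (x - z) - u x\<bar> \<le> l * a" if "norm z \<le> a" for z
      using bounded_lipschitzD(2)[OF u, of "x - z" x] mult_left_mono[OF that l] by simp
  qed
  finally show ?thesis .
qed

text \<open>Subadditivity of \<open>E\<close> covers finite sums only, so the mollifying integral is
  replaced by a finite average. The nodes are the values of a simple function close to the identity,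
  weighted by the kernel mass of its level sets. Nodes and weights are independent of
  \<open>u\<close>, so that one choice can serve both a function and its image under a step.\<close>

lemma mollify_finite_average:
  assumes a: "0 < a" and \<delta>: "0 < \<delta>"
  obtains F :: "'a::euclidean_space set" and w
  where "finite F" "\<And>c. c \<in> F \<Longrightarrow> 0 \<le> w c"
    "\<And>M l u x. u \<in> bounded_lipschitz M l \<Longrightarrow> 0 \<le> l \<Longrightarrow>
       \<bar>mollify a u x - (\<Sum>c\<in>F. w c * u (x - c))\<bar> \<le> l * \<delta>"
proof -
  define Z where "Z = (\<integral>y. bump a (y::'a) \<partial>lborel)"
  have Z: "Z > 0" using integral_bump_pos[OF a] by (simp add: Z_def)
  \<comment> \<open>Simple functions tending to the identity; the bound by \<open>2 * norm y\<close>
    supplies the dominating function \<open>bump a y * (3 * norm y)\<close>.\<close>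
  obtain s :: "nat \<Rightarrow> 'a \<Rightarrow> 'a" where s: "\<And>i. simple_function lborel (s i)"
    "\<And>y. (\<lambda>i. s i y) \<longlonglongrightarrow> y" "\<And>i y. norm (s i y) \<le> 2 * norm y"
    using borel_measurable_implies_sequence_metric[of "\<lambda>y::'a. y" lborel 0] by auto
  have sm[measurable]: "s i \<in> borel_measurable borel" for i
    using borel_measurable_simple_function[OF s(1)[of i]] by simp
  have bm[measurable]: "bump a \<in> borel_measurable (borel :: 'a measure)"
    by (intro borel_measurable_continuous_onI continuous_bump)
  have dom: "integrable lborel (\<lambda>y::'a. bump a y * (3 * norm y))"
    by (intro integrable_bump_mult a continuous_intros)
  have bd: "norm (bump a y * norm (y - s i y)) \<le> bump a y * (3 * norm y)" for i y
  proof -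
    have "norm (y - s i y) \<le> 3 * norm y" using norm_triangle_ineq4[of y "s i y"] s(3)[of i y] by linarith
    then show ?thesis using bump_nonneg[of a y] by (simp add: mult_left_mono abs_mult)
  qed
  have lim: "(\<lambda>i. \<integral>y. bump a y * norm (y - s i y) \<partial>lborel) \<longlonglongrightarrow> (\<integral>y. 0 \<partial>(lborel :: 'a measure))"
  proof (rule integral_dominated_convergence[OF _ _ dom])
    show "AE y in lborel. (\<lambda>i. bump a y * norm (y - s i y)) \<longlonglongrightarrow> 0"
    proof (rule AE_I2)
      fix y
      have "(\<lambda>i. bump a y * norm (y - s i y)) \<longlonglongrightarrow> bump a y * norm (y - y)"
        by (intro tendsto_intros s(2))
      then show "(\<lambda>i. bump a y * norm (y - s i y)) \<longlonglongrightarrow> 0" by simp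
    qed
  qed (use bd in auto)
  then have "eventually (\<lambda>i. (\<integral>y. bump a y * norm (y - s i y) \<partial>lborel) < \<delta> * Z) sequentially"
    using Z \<delta> by (intro order_tendstoD(2)[OF lim]) simp
  then obtain i where i: "(\<integral>y. bump a y * norm (y - s i y) \<partial>lborel) < \<delta> * Z"
    by (auto simp: eventually_sequentially)
  have di: "integrable lborel (\<lambda>y. bump a y * norm (y - s i y))"
    by (rule Bochner_Integration.integrable_bound[OF dom]) (use bd[of _ i] in \<open>auto simp: abs_mult bump_nonneg\<close>)
  define F where "F = range (s i)"
  define w where "w c = (\<integral>y. bump a y * indicator (s i -` {c}) y \<partial>lborel) / Z" for c
  have F: "finite F" using simple_functionD(1)[OF s(1)[of i]] by (simp add: F_def)
  have bi: "integrable lborel (\<lambda>y. bump a y * indicator (s i -` {c}) y)" for c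
  proof (rule Bochner_Integration.integrable_bound[OF integrable_bump_mult[OF a, of "\<lambda>_. 1"]])
    have "s i -` {c} \<in> sets borel" using measurable_sets[OF sm[of i], of "{c}"] by simp
    then show "(\<lambda>y. bump a y * indicator (s i -` {c}) y) \<in> borel_measurable lborel" by measurable
  qed (auto simp: indicator_def)
  show thesis
  proof (rule that[OF F, of w])
    show "0 \<le> w c" for c
      unfolding w_def using Z by (intro divide_nonneg_pos integral_nonneg_AE) (auto simp: bump_nonneg)
    fix M l and u :: "'a \<Rightarrow> real" and x
    assume u: "u \<in> bounded_lipschitz M l" and l: "0 \<le> l"
    have um: "u \<in> borel_measurable borel"
      by (intro borel_measurable_continuous_onI continuous_bounded_lipschitz[OF u])
    \<comment> \<open>At each \<open>y\<close> only the node \<open>c = s i y\<close>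
      contributes.\<close>
    have e: "(\<Sum>c\<in>F. (bump a y * indicator (s i -` {c}) y) * u (x - c)) = bump a y * u (x - s i y)" for y
    proof -
      have "(\<Sum>c\<in>F. (bump a y * indicator (s i -` {c}) y) * u (x - c)) =
          (\<Sum>c\<in>F. if c = s i y then bump a y * u (x - c) else 0)"
        by (intro sum.cong) (auto simp: indicator_def)
      then show ?thesis using F by (simp add: F_def)
    qed
    have "(\<Sum>c\<in>F. w c * u (x - c)) * Z =
        (\<Sum>c\<in>F. (\<integral>y. (bump a y * indicator (s i -` {c}) y) * u (x - c) \<partial>lborel))"
      using Z by (simp add: w_def sum_distrib_right)
    also have "\<dots> = (\<integral>y. (\<Sum>c\<in>F. (bump a y * indicator (s i -` {c}) y) * u (x - c)) \<partial>lborel)"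
      by (subst Bochner_Integration.integral_sum) (auto intro!: bi integrable_mult_left)
    finally have S: "(\<Sum>c\<in>F. w c * u (x - c)) * Z = (\<integral>y. bump a y * u (x - s i y) \<partial>lborel)"
      by (simp only: e)
    have Si: "integrable lborel (\<lambda>y. bump a y * u (x - s i y))"
      unfolding e[symmetric] by (intro Bochner_Integration.integrable_sum integrable_mult_left bi)
    have Mi: "integrable lborel (\<lambda>y. bump a y * u (x - y))"
      by (intro integrable_bump_mult a continuous_reflect[OF u])
    have "\<bar>(\<integral>y. bump a y * u (x - y) \<partial>lborel) - (\<integral>y. bump a y * u (x - s i y) \<partial>lborel)\<bar>
        = \<bar>\<integral>y. bump a y * u (x - y) - bump a y * u (x - s i y) \<partial>lborel\<bar>"
      using Mi Si by simp
    also have "\<dots> \<le> (\<integral>y. \<bar>bump a y * u (x - y) - bump a y * u (x - s i y)\<bar> \<partial>lborel)"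
      by (rule integral_abs_bound)
    also have "\<dots> \<le> (\<integral>y. l * (bump a y * norm (y - s i y)) \<partial>lborel)"
    proof (rule integral_mono)
      show "integrable lborel (\<lambda>y. \<bar>bump a y * u (x - y) - bump a y * u (x - s i y)\<bar>)"
        by (intro integrable_abs Bochner_Integration.integrable_diff Mi Si)
      show "integrable lborel (\<lambda>y. l * (bump a y * norm (y - s i y)))" by (intro integrable_mult_right di)
      fix y
      have "\<bar>u (x - y) - u (x - s i y)\<bar> \<le> l * norm (y - s i y)"
        using bounded_lipschitzD(2)[OF u, of "x - y" "x - s i y"] by (simp add: norm_minus_commute)
      from mult_left_mono[OF this bump_nonneg[of a y]]
      show "\<bar>bump a y * u (x - y) - bump a y * u (x - s i y)\<bar> \<le> l * (bump a y * norm (y - s i y))"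
        by (simp add: right_diff_distrib[symmetric] abs_mult bump_nonneg mult_ac)
    qed
    also have "\<dots> \<le> l * (\<delta> * Z)" using i l by (simp add: mult_left_mono)
    finally have "\<bar>mollify a u x * Z - (\<Sum>c\<in>F. w c * u (x - c)) * Z\<bar> \<le> l * \<delta> * Z"
      using Z unfolding S by (simp add: mollify_def Z_def[symmetric] mult_ac)
    then have "\<bar>mollify a u x - (\<Sum>c\<in>F. w c * u (x - c))\<bar> * Z \<le> l * \<delta> * Z"
      using Z by (simp add: left_diff_distrib[symmetric] abs_mult)
    then show "\<bar>mollify a u x - (\<Sum>c\<in>F. w c * u (x - c))\<bar> \<le> l * \<delta>" using Z by simp
  qed
qed

text \<open>The derivatives fall on the kernel, so \<open>u\<close> need only be bounded.\<close>

lemma mollify_second_order_expansion: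
  assumes a: "0 < a" "a \<le> 1"
  obtains L where "0 \<le> L"
    "\<And>l u :: real ^ 'd \<Rightarrow> real. u \<in> bounded_lipschitz M l \<Longrightarrow> second_order_expansion L (mollify a u)"
proof -
  define Z where "Z = (\<integral>y. bump a (y :: real ^ 'd) \<partial>lborel)"
  have Z: "Z > 0" using integral_bump_pos[OF a(1)] by (simp add: Z_def)
  define V where "V = unit_ball_vol (real DIM(real ^ 'd)) * a ^ DIM(real ^ 'd)"
  have V: "0 \<le> V" using a by (simp add: V_def)
  have cb: "measure lborel (cball x a) = V" for x :: "real ^ 'd"
    using content_cball[of a x] a by (simp add: V_def)
  have ci: "integrable lborel (indicat_real (cball x a))" for x :: "real ^ 'd"
    using emeasure_lborel_cball_finite[of x a] by (intro integrable_real_indicator) auto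
  \<comment> \<open>\<open>1780\<close> is the constant of the kernel expansion,
    \<open>2 * V\<close> the volume of the two balls carrying its remainder, and \<open>Z\<close>
    the normalisation.\<close>
  define L where "L = \<bar>M\<bar> * (1780 * (2 * V)) / Z"
  have "second_order_expansion L (mollify a u)" if u: "u \<in> bounded_lipschitz M l"
    for l and u :: "real ^ 'd \<Rightarrow> real"
    unfolding second_order_expansion_def
  proof
    fix x :: "real ^ 'd"
    note uc = continuous_bounded_lipschitz[OF u]
    define r where "r w = max 0 (a\<^sup>2 - (norm w)\<^sup>2)" for w :: "real ^ 'd"
    have r0: "r w = 0" if "w \<notin> cball 0 a" for w
    proof -
      have "a\<^sup>2 \<le> (norm w)\<^sup>2" using a that by (intro power_mono) auto
      then show ?thesis by (simp add: r_def)
    qed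
    have rc: "continuous_on S r" for S unfolding r_def[abs_def] by (intro continuous_intros)
    \<comment> \<open>\<open>b\<close> and \<open>B\<close> are the gradient and the Hessian of the
      kernel; their integrals against \<open>u\<close> give \<open>p\<close> and
      \<open>A\<close>.\<close>
    define b where "b w = (- 8 * r w ^ 3) *\<^sub>R w" for w
    define B :: "real ^ 'd \<Rightarrow> real ^ 'd ^ 'd" where
      "B w = (\<chi> i j. 48 * (r w)\<^sup>2 * (w $ i) * (w $ j) - (if i = j then 8 * r w ^ 3 else 0))" for w
    have Bc: "continuous_on S B" for S
      unfolding B_def[abs_def]
    proof (intro continuous_on_vec_lambda)
      fix i j
      show "continuous_on S (\<lambda>w. 48 * (r w)\<^sup>2 * w $ i * w $ j - (if i = j then 8 * r w ^ 3 else 0))"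
        by (cases "i = j") (auto intro!: continuous_intros rc)
    qed
    have Bq: "(B w *v \<xi>) \<bullet> \<xi> = 48 * (r w)\<^sup>2 * (w \<bullet> \<xi>)\<^sup>2 - 8 * r w ^ 3 * (norm \<xi>)\<^sup>2" for w \<xi>
    proof -
      have "(B w *v \<xi>) $ i = 48 * (r w)\<^sup>2 * (w \<bullet> \<xi>) * w $ i - 8 * r w ^ 3 * \<xi> $ i" for i
      proof -
        have "(B w *v \<xi>) $ i =
            (\<Sum>j\<in>UNIV. 48 * (r w)\<^sup>2 * w $ i * (w $ j * \<xi> $ j) - (if i = j then 8 * r w ^ 3 * \<xi> $ j else 0))"
          unfolding matrix_vector_mult_def B_def by (auto intro!: sum.cong simp: algebra_simps)
        then show ?thesis
          by (simp add: sum_subtractf sum_distrib_left sum_distrib_right inner_vec_def mult_ac)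
      qed
      then have "B w *v \<xi> = (48 * (r w)\<^sup>2 * (w \<bullet> \<xi>)) *\<^sub>R w - (8 * r w ^ 3) *\<^sub>R \<xi>"
        by (simp add: vec_eq_iff)
      then show ?thesis 
        by (simp add: inner_diff_left dot_square_norm power2_eq_square[of "w \<bullet> \<xi>"])
    qed
    have int: "integrable lborel (\<lambda>z. u z *\<^sub>R g (y - z))"
      if "continuous_on UNIV g" "\<And>w. w \<notin> cball 0 a \<Longrightarrow> g w = 0"
      for y and g :: "real ^ 'd \<Rightarrow> 'e::euclidean_space"
    proof (rule integrable_continuous_compact_support[where x = y and a = a])
      show "continuous_on UNIV (\<lambda>z. u z *\<^sub>R g (y - z))"
        by (intro continuous_intros uc continuous_on_compose2[OF that(1)]) auto
      show "u z *\<^sub>R g (y - z) = 0" if "z \<notin> cball y a" for z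
        using that \<open>\<And>w. w \<notin> cball 0 a \<Longrightarrow> g w = 0\<close>[of "y - z"]
        by (simp add: dist_norm norm_minus_commute)
    qed
    have ib: "integrable lborel (\<lambda>z. u z *\<^sub>R b (x - z))"
      by (rule int) (auto simp: b_def[abs_def] r0 intro!: continuous_intros rc)
    have iB: "integrable lborel (\<lambda>z. u z *\<^sub>R B (x - z))"
      by (rule int[OF Bc]) (simp add: B_def r0 vec_eq_iff)
    have ibump: "integrable lborel (\<lambda>z. u z * bump a (y - z))" for y
      using int[of "bump a" y] bump_zero[OF a(1)] continuous_bump by auto
    define p where "p = (1 / Z) *\<^sub>R (\<integral>z. u z *\<^sub>R b (x - z) \<partial>lborel)"
    define A where "A = (1 / Z) *\<^sub>R (\<integral>z. u z *\<^sub>R B (x - z) \<partial>lborel)"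
    \<comment> \<open>After the reflection the point \<open>y\<close> occurs in the kernel alone, so
      an increment of the mollified function becomes an increment of \<open>bump a\<close>.\<close>
    have mol: "mollify a u y * Z = (\<integral>z. u z * bump a (y - z) \<partial>lborel)" for y
    proof -
      have "(\<integral>z. bump a z * u (y - z) \<partial>lborel) = (\<integral>z. u z * bump a (y - z) \<partial>lborel)"
        using lborel_integral_reflect[of "\<lambda>z. u z * bump a (y - z)" y] borel_measurable_integrable[OF ibump]
        by (simp add: mult.commute)
      then show ?thesis using Z by (simp add: mollify_def Z_def[symmetric])
    qed
    have "transpose A = A"
    proof -
      have "bounded_linear (transpose :: real ^ 'd ^ 'd \<Rightarrow> _)"
        by (intro linear_conv_bounded_linear[THEN iffD1] linearI) (simp_all add: transpose_def vec_eq_iff)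
      from integral_bounded_linear[OF this iB]
      have "transpose (\<integral>z. u z *\<^sub>R B (x - z) \<partial>lborel) = (\<integral>z. transpose (u z *\<^sub>R B (x - z)) \<partial>lborel)"
        by simp
      moreover have "transpose (B w) = B w" for w
        by (simp add: transpose_def vec_eq_iff B_def mult_ac)
      ultimately show ?thesis by (simp add: A_def transpose_scalar)
    qed
    moreover have "\<bar>mollify a u (x + \<xi>) - mollify a u x - p \<bullet> \<xi> - 1 / 2 * ((A *v \<xi>) \<bullet> \<xi>)\<bar>
        \<le> L * norm \<xi> ^ 3" for \<xi>
    proof -
      have pi: "integrable lborel (\<lambda>z. u z * (b (x - z) \<bullet> \<xi>))"
        "(p \<bullet> \<xi>) * Z = (\<integral>z. u z * (b (x - z) \<bullet> \<xi>) \<partial>lborel)"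
        using integrable_inner_left[OF ib, of \<xi>] integral_inner_left[OF ib, of \<xi>] Z
        by (simp_all add: p_def)
      have lin: "bounded_linear (\<lambda>C :: real ^ 'd ^ 'd. (C *v \<xi>) \<bullet> \<xi>)"
        by (intro linear_conv_bounded_linear[THEN iffD1] linearI)
          (simp_all add: matrix_vector_mult_add_rdistrib inner_add_left scaleR_matrix_vector_assoc[symmetric])
      have Ai: "integrable lborel (\<lambda>z. u z * ((B (x - z) *v \<xi>) \<bullet> \<xi>))"
        "((A *v \<xi>) \<bullet> \<xi>) * Z = (\<integral>z. u z * ((B (x - z) *v \<xi>) \<bullet> \<xi>) \<partial>lborel)"
        using integrable_bounded_linear[OF lin iB] integral_bounded_linear[OF lin iB] Z
        by (simp_all add: A_def scaleR_matrix_vector_assoc[symmetric])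
      define R where "R w = bump a (w + \<xi>) - bump a w - b w \<bullet> \<xi> - 1 / 2 * ((B w *v \<xi>) \<bullet> \<xi>)" for w
      have Rb: "\<bar>R w\<bar> \<le> 1780 * norm \<xi> ^ 3 * (indicator (cball 0 a) w + indicator (cball 0 a) (w + \<xi>))" for w
      proof -
        have "R w = bump a (w + \<xi>) - bump a w + 8 * r w ^ 3 * (w \<bullet> \<xi>)
            - (24 * (r w)\<^sup>2 * (w \<bullet> \<xi>)\<^sup>2 - 4 * r w ^ 3 * (norm \<xi>)\<^sup>2)"
          unfolding R_def Bq by (simp add: b_def diff_divide_distrib)
        then show ?thesis using bump_expansion[OF a, of w \<xi>] by (simp add: r_def)
      qed
      have Rz: "u z * R (x - z) = u z * bump a (x + \<xi> - z) - u z * bump a (x - z)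
          - u z * (b (x - z) \<bullet> \<xi>) - 1 / 2 * (u z * ((B (x - z) *v \<xi>) \<bullet> \<xi>))" for z
        by (simp add: R_def algebra_simps)
      have Ri: "integrable lborel (\<lambda>z. u z * R (x - z))"
        unfolding Rz
        by (intro Bochner_Integration.integrable_diff integrable_mult_right ibump pi(1) Ai(1))
      have "(mollify a u (x + \<xi>) - mollify a u x - p \<bullet> \<xi> - 1 / 2 * ((A *v \<xi>) \<bullet> \<xi>)) * Z =
          (\<integral>z. u z * R (x - z) \<partial>lborel)"
        unfolding Rz
        by (subst Bochner_Integration.integral_diff, intro Bochner_Integration.integrable_diff ibump pi(1),
            intro integrable_mult_right Ai(1),
            subst Bochner_Integration.integral_diff, intro Bochner_Integration.integrable_diff ibump,
            rule pi(1), subst Bochner_Integration.integral_diff, rule ibump, rule ibump)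
          (simp add: mol pi(2) Ai(2)[symmetric] left_diff_distrib)
      also have "\<bar>\<dots>\<bar> \<le> (\<integral>z. \<bar>u z * R (x - z)\<bar> \<partial>lborel)" by (rule integral_abs_bound)
      also have "\<dots> \<le> (\<integral>z. (\<bar>M\<bar> * (1780 * norm \<xi> ^ 3)) *
          (indicator (cball x a) z + indicator (cball (x + \<xi>) a) z) \<partial>lborel)"
      proof (rule integral_mono)
        show "integrable lborel (\<lambda>z. \<bar>u z * R (x - z)\<bar>)" using Ri by (rule integrable_abs)
        show "integrable lborel (\<lambda>z. (\<bar>M\<bar> * (1780 * norm \<xi> ^ 3)) *
            (indicat_real (cball x a) z + indicator (cball (x + \<xi>) a) z))"
          by (intro integrable_mult_right Bochner_Integration.integrable_add ci)
        fix z
        have i: "indicat_real (cball 0 a) (x - z) = indicator (cball x a) z"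
          "indicat_real (cball 0 a) (x - z + \<xi>) = indicator (cball (x + \<xi>) a) z"
          by (simp_all add: indicator_def dist_norm[of x z] dist_norm[of "\<xi> + x" z] algebra_simps)
        have "\<bar>u z\<bar> \<le> \<bar>M\<bar>" using bounded_lipschitzD(1)[OF u, of z] by simp
        then have "\<bar>u z\<bar> * \<bar>R (x - z)\<bar> \<le> \<bar>M\<bar> *
            (1780 * norm \<xi> ^ 3 * (indicator (cball x a) z + indicator (cball (x + \<xi>) a) z))"
          using Rb[of "x - z"] unfolding i by (intro mult_mono) auto
        then show "\<bar>u z * R (x - z)\<bar> \<le> (\<bar>M\<bar> * (1780 * norm \<xi> ^ 3)) *
            (indicator (cball x a) z + indicator (cball (x + \<xi>) a) z)"
          by (simp add: abs_mult mult.assoc)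
      qed
      also have "\<dots> = (\<bar>M\<bar> * (1780 * norm \<xi> ^ 3)) * (V + V)"
        using ci by (simp add: cb)
      also have "\<dots> = L * norm \<xi> ^ 3 * Z" using Z by (simp add: L_def)
      finally show ?thesis using Z by (simp add: abs_mult)
    qed
    ultimately show "\<exists>p A. transpose A = A \<and>
        (\<forall>\<xi>. \<bar>mollify a u (x + \<xi>) - mollify a u x - p \<bullet> \<xi> - 1 / 2 * ((A *v \<xi>) \<bullet> \<xi>)\<bar> \<le> L * norm \<xi> ^ 3)"
      by blast
  qed
  moreover have "0 \<le> L" using Z V by (simp add: L_def)
  ultimately show thesis using that by blast
qed

section \<open>Comparison of schemes with the same generator\<close>

text \<open>Jensen's inequality: on a finite average with nonnegative weights it is subadditivity
  and positive homogeneity, and translation by a node commutes with the step. The same average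
  approximates \<open>mollify a u\<close> and, since the Lipschitz constant is preserved, also
  \<open>mollify a (step_op E Y u)\<close>.\<close>

lemma (in sublinear_expectation_space) step_op_mollify_le:
  fixes u :: "real ^ 'd \<Rightarrow> real"
  assumes Y: "random_vector H Y" and u: "u \<in> bounded_lipschitz M l" and a: "0 < a"
  shows "step_op E Y (mollify a u) x \<le> mollify a (step_op E Y u) x"
proof (rule field_le_epsilon)
  fix e :: real
  assume e: "0 < e"
  have l: "0 \<le> l" by (rule lipschitz_nonneg[OF u])
  \<comment> \<open>The approximation is used twice, at cost \<open>l * \<delta>\<close> each;
    \<open>l + 1\<close> avoids a division by zero.\<close>
  define \<delta> where "\<delta> = e / (2 * (l + 1))"
  have \<delta>: "0 < \<delta>" using e l by (simp add: \<delta>_def)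
  have le: "2 * (l * \<delta>) \<le> e"
  proof -
    have "2 * (l * \<delta>) \<le> 2 * ((l + 1) * \<delta>)" using \<delta> by (simp add: algebra_simps)
    also have "\<dots> = e" using l by (simp add: \<delta>_def divide_simps)
    finally show ?thesis .
  qed
  obtain F :: "(real ^ 'd) set" and w where F: "finite F" "\<And>c. c \<in> F \<Longrightarrow> 0 \<le> w c"
    and av: "\<And>M l u x. u \<in> bounded_lipschitz M l \<Longrightarrow> 0 \<le> l \<Longrightarrow>
       \<bar>mollify a u x - (\<Sum>c\<in>F. w c * u (x - c))\<bar> \<le> l * \<delta>"
    using mollify_finite_average[OF a \<delta>] by blast
  have m: "(\<lambda>\<omega>. u (x - c + Y \<omega>)) \<in> H" for c by (rule bounded_lipschitz_mem[OF Y u])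
  have "step_op E Y (mollify a u) x \<le> E (\<lambda>\<omega>. \<Sum>c\<in>F. w c * u (x - c + Y \<omega>)) + l * \<delta>"
    unfolding step_op_def
  proof (intro expectation_le_add sum_mem scale_mem m F(1))
    show "(\<lambda>\<omega>. mollify a u (x + Y \<omega>)) \<in> H"
      by (rule bounded_lipschitz_mem[OF Y mollify_bounded_lipschitz[OF a u]])
    show "mollify a u (x + Y \<omega>) \<le> (\<Sum>c\<in>F. w c * u (x - c + Y \<omega>)) + l * \<delta>" for \<omega>
      using av[OF u l, of "x + Y \<omega>"] by (simp add: algebra_simps)
  qed
  also have "E (\<lambda>\<omega>. \<Sum>c\<in>F. w c * u (x - c + Y \<omega>)) \<le> (\<Sum>c\<in>F. E (\<lambda>\<omega>. w c * u (x - c + Y \<omega>)))"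
    by (intro expectation_sum_le F(1) scale_mem m)
  also have "\<dots> = (\<Sum>c\<in>F. w c * step_op E Y u (x - c))"
    using F(2) by (intro sum.cong) (simp_all add: step_op_def pos_hom[OF m])
  also have "\<dots> \<le> mollify a (step_op E Y u) x + l * \<delta>"
    using av[OF step_op_bounded_lipschitz[OF Y u] l, of x] by linarith
  finally show "step_op E Y (mollify a u) x \<le> mollify a (step_op E Y u) x + e"
    using le by linarith
qed

text \<open>An induction step chains monotonicity of the \<open>W\<close>-step, the hypothesis
  \<open>step\<close> at the function \<open>mollify a un\<close>, and Jensen for the
  \<open>Y\<close>-step. As \<open>un\<close> keeps \<open>M\<close> and \<open>l\<close>, the same
  \<open>L\<close> and \<open>\<kappa>\<close> serve at every stage.\<close>

lemma funpow_mollify_le: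
  fixes Y :: "'w \<Rightarrow> real ^ 'd" and W :: "'v \<Rightarrow> real ^ 'd"
  assumes E: "sublinear_expectation_space H E" and E': "sublinear_expectation_space H' E'"
    and Y: "random_vector H Y" and W: "random_vector H' W"
    and u: "u \<in> bounded_lipschitz M l" and a: "0 < a"
    and moll: "\<And>u :: real ^ 'd \<Rightarrow> real. u \<in> bounded_lipschitz M l \<Longrightarrow> second_order_expansion L (mollify a u)"
    and step: "\<And>v x. v \<in> bounded_lipschitz M l \<Longrightarrow> second_order_expansion L v \<Longrightarrow>
                 step_op E' W v x \<le> step_op E Y v x + \<kappa>"
  shows "(step_op E' W ^^ n) (mollify a u) x \<le> mollify a ((step_op E Y ^^ n) u) x + real n * \<kappa>"
proof (induction n arbitrary: x)
  case 0
  then show ?case by simp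
next
  case (Suc n)
  interpret E: sublinear_expectation_space H E by (rule E)
  interpret E': sublinear_expectation_space H' E' by (rule E')
  define un where "un = (step_op E Y ^^ n) u"
  have un: "un \<in> bounded_lipschitz M l"
    unfolding un_def by (rule E.step_op_funpow_bounded_lipschitz[OF Y u])
  note mu = mollify_bounded_lipschitz[OF a un]
  have "step_op E' W ((step_op E' W ^^ n) (mollify a u)) x
      \<le> step_op E' W (mollify a un) x + real n * \<kappa>"
    using Suc unfolding un_def[symmetric]
    by (intro E'.step_op_le_add[OF W
          E'.step_op_funpow_bounded_lipschitz[OF W mollify_bounded_lipschitz[OF a u]] mu])
  also have "step_op E' W (mollify a un) x \<le> step_op E Y (mollify a un) x + \<kappa>"
    by (rule step[OF mu moll[OF un]])
  also have "step_op E Y (mollify a un) x \<le> mollify a (step_op E Y un) x"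
    by (rule E.step_op_mollify_le[OF Y un a])
  finally show ?case by (simp add: un_def algebra_simps)
qed

text \<open>Mollification is inserted before the first step and removed after the last; each costs
  \<open>l * a\<close>, the former because the iterates are monotone and commute with
  constants.\<close>

lemma funpow_le:
  fixes Y :: "'w \<Rightarrow> real ^ 'd" and W :: "'v \<Rightarrow> real ^ 'd"
  assumes E: "sublinear_expectation_space H E" and E': "sublinear_expectation_space H' E'"
    and Y: "random_vector H Y" and W: "random_vector H' W"
    and u: "u \<in> bounded_lipschitz M l" and a: "0 < a"
    and moll: "\<And>u :: real ^ 'd \<Rightarrow> real. u \<in> bounded_lipschitz M l \<Longrightarrow> second_order_expansion L (mollify a u)"
    and step: "\<And>v x. v \<in> bounded_lipschitz M l \<Longrightarrow> second_order_expansion L v \<Longrightarrow>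
                 step_op E' W v x \<le> step_op E Y v x + \<kappa>"
  shows "(step_op E' W ^^ n) u x \<le> (step_op E Y ^^ n) u x + (real n * \<kappa> + 2 * (l * a))"
proof -
  interpret E: sublinear_expectation_space H E by (rule E)
  interpret E': sublinear_expectation_space H' E' by (rule E')
  have l: "0 \<le> l" by (rule lipschitz_nonneg[OF u])
  have "u y \<le> mollify a u y + l * a" for y using mollify_approx[OF a u l, of y] by linarith
  then have "(step_op E' W ^^ n) u x \<le> (step_op E' W ^^ n) (mollify a u) x + l * a"
    by (rule E'.step_op_funpow_le_add[OF W u mollify_bounded_lipschitz[OF a u]])
  also have "(step_op E' W ^^ n) (mollify a u) x \<le> mollify a ((step_op E Y ^^ n) u) x + real n * \<kappa>"
    by (rule funpow_mollify_le[OF assms])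
  also have "mollify a ((step_op E Y ^^ n) u) x \<le> (step_op E Y ^^ n) u x + l * a"
    using mollify_approx[OF a E.step_op_funpow_bounded_lipschitz[OF Y u, of n] l, of x] by linarith
  finally show ?thesis by linarith
qed

lemma funpow_step_op_diff_tendsto_0:
  fixes Y :: "'w \<Rightarrow> real ^ 'd" and W :: "'v \<Rightarrow> real ^ 'd"
  assumes E: "sublinear_expectation_space H E" and E': "sublinear_expectation_space H' E'"
    and Y: "random_vector H Y" and W: "random_vector H' W"
    and meanY: "\<And>k. E (\<lambda>\<omega>. Y \<omega> $ k) = 0" "\<And>k. E (\<lambda>\<omega>. - (Y \<omega> $ k)) = 0"
    and meanW: "\<And>k. E' (\<lambda>\<omega>. W \<omega> $ k) = 0" "\<And>k. E' (\<lambda>\<omega>. - (W \<omega> $ k)) = 0"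
    and G: "\<And>A. transpose A = A \<Longrightarrow> G_function E' W A = G_function E Y A"
    and u: "u \<in> bounded_lipschitz M l"
  shows "(\<lambda>n. (step_op E (\<lambda>\<omega>. (1 / sqrt (real n)) *\<^sub>R Y \<omega>) ^^ n) u x
            - (step_op E' (\<lambda>\<omega>. (1 / sqrt (real n)) *\<^sub>R W \<omega>) ^^ n) u x) \<longlonglongrightarrow> 0"
proof (rule LIMSEQ_I)
  fix e :: real
  assume e: "0 < e"
  interpret E: sublinear_expectation_space H E by (rule E)
  interpret E': sublinear_expectation_space H' E' by (rule E')
  have l: "0 \<le> l" by (rule lipschitz_nonneg[OF u])
  \<comment> \<open>The kernel expansion requires \<open>a \<le> 1\<close>; the other bound gives
    \<open>2 * (l * a) \<le> e / 2\<close>, leaving the other half of \<open>e\<close> for the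
    consistency errors.\<close>
  define a where "a = min 1 (e / (4 * (l + 1)))"
  have a: "0 < a" "a \<le> 1" using e l by (simp_all add: a_def)
  have la: "2 * (l * a) \<le> e / 2"
  proof -
    have "l * a \<le> (l + 1) * (e / (4 * (l + 1)))" using a l by (intro mult_mono) (auto simp: a_def)
    also have "\<dots> = e / 4" using l by (simp add: divide_simps)
    finally show ?thesis by simp
  qed
  obtain L where L: "0 \<le> L"
    and moll: "\<And>l u :: real ^ 'd \<Rightarrow> real. u \<in> bounded_lipschitz M l \<Longrightarrow> second_order_expansion L (mollify a u)"
    using mollify_second_order_expansion[OF a] by blast
  define K where "K = E (\<lambda>\<omega>. norm (Y \<omega>) ^ 3) + E' (\<lambda>\<omega>. norm (W \<omega>) ^ 3)"
  \<comment> \<open>Both steps are expanded with the same \<open>p\<close> and \<open>A\<close>;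
    equality of the two functions \<open>G\<close> cancels everything up to second order.\<close>
  have cons: "\<bar>step_op E (\<lambda>\<omega>. s *\<^sub>R Y \<omega>) v y - step_op E' (\<lambda>\<omega>. s *\<^sub>R W \<omega>) v y\<bar> \<le> L * s ^ 3 * K"
    if v: "v \<in> bounded_lipschitz M l" "second_order_expansion L v" and s: "0 \<le> s" for v y s
  proof -
    obtain p A where A: "transpose A = A"
      "\<And>\<xi>. \<bar>v (y + \<xi>) - v y - p \<bullet> \<xi> - 1 / 2 * ((A *v \<xi>) \<bullet> \<xi>)\<bar> \<le> L * norm \<xi> ^ 3"
      using v(2) unfolding second_order_expansion_def by blast
    show ?thesis
      using E.step_op_expansion[OF Y meanY v(1) A(2) s L] E'.step_op_expansion[OF W meanW v(1) A(2) s L]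
      unfolding G[OF A(1)] K_def distrib_left by linarith
  qed
  have "(\<lambda>n. sqrt (inverse (real n))) \<longlonglongrightarrow> sqrt 0"
    by (intro tendsto_real_sqrt lim_inverse_n)
  then have "(\<lambda>n. 1 / sqrt (real n)) \<longlonglongrightarrow> 0"
    by (simp add: real_sqrt_divide inverse_eq_divide)
  then have "(\<lambda>n. L * K * (1 / sqrt (real n))) \<longlonglongrightarrow> L * K * 0"
    by (intro tendsto_mult tendsto_const)
  then have "eventually (\<lambda>n. L * K * (1 / sqrt (real n)) < e / 2) sequentially"
    using e by (intro order_tendstoD(2)) auto
  then obtain N where N: "\<And>n. n \<ge> N \<Longrightarrow> L * K * (1 / sqrt (real n)) < e / 2"
    by (auto simp: eventually_sequentially)
  show "\<exists>N. \<forall>n\<ge>N. norm ((step_op E (\<lambda>\<omega>. (1 / sqrt (real n)) *\<^sub>R Y \<omega>) ^^ n) u x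
            - (step_op E' (\<lambda>\<omega>. (1 / sqrt (real n)) *\<^sub>R W \<omega>) ^^ n) u x - 0) < e"
  proof (intro exI allI impI)
    fix n
    \<comment> \<open>\<open>n = 0\<close> must be excluded: there \<open>1 / sqrt 0 = 0\<close> and
      \<open>real n * s\<^sup>2 = 1\<close> fails.\<close>
    assume n: "max 1 N \<le> n"
    define s where "s = 1 / sqrt (real n)"
    have s: "0 \<le> s" by (simp add: s_def)
    have ns: "real n * s\<^sup>2 = 1" using n by (simp add: s_def power_divide)
    have "real n * (L * s ^ 3 * K) = (real n * s\<^sup>2) * (L * K * s)" by algebra
    also have "\<dots> = L * K * s" by (simp add: ns)
    also have "\<dots> < e / 2" using N[of n] n by (simp add: s_def)
    finally have small: "real n * (L * s ^ 3 * K) < e / 2" .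
    note sY = E.random_vector_scale[OF Y, of s] and sW = E'.random_vector_scale[OF W, of s]
    have "(step_op E' (\<lambda>\<omega>. s *\<^sub>R W \<omega>) ^^ n) u x
        \<le> (step_op E (\<lambda>\<omega>. s *\<^sub>R Y \<omega>) ^^ n) u x + (real n * (L * s ^ 3 * K) + 2 * (l * a))"
    proof (rule funpow_le[OF E E' sY sW u a(1) moll])
      show "step_op E' (\<lambda>\<omega>. s *\<^sub>R W \<omega>) v x \<le> step_op E (\<lambda>\<omega>. s *\<^sub>R Y \<omega>) v x + L * s ^ 3 * K"
        if "v \<in> bounded_lipschitz M l" "second_order_expansion L v" for v x
        using cons[OF that s, of x] by linarith
    qed
    moreover have "(step_op E (\<lambda>\<omega>. s *\<^sub>R Y \<omega>) ^^ n) u x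
        \<le> (step_op E' (\<lambda>\<omega>. s *\<^sub>R W \<omega>) ^^ n) u x + (real n * (L * s ^ 3 * K) + 2 * (l * a))"
    proof (rule funpow_le[OF E' E sW sY u a(1) moll])
      show "step_op E (\<lambda>\<omega>. s *\<^sub>R Y \<omega>) v x \<le> step_op E' (\<lambda>\<omega>. s *\<^sub>R W \<omega>) v x + L * s ^ 3 * K"
        if "v \<in> bounded_lipschitz M l" "second_order_expansion L v" for v x
        using cons[OF that s, of x] by linarith
    qed
    ultimately show "norm ((step_op E (\<lambda>\<omega>. (1 / sqrt (real n)) *\<^sub>R Y \<omega>) ^^ n) u x
            - (step_op E' (\<lambda>\<omega>. (1 / sqrt (real n)) *\<^sub>R W \<omega>) ^^ n) u x - 0) < e"
      using small la unfolding s_def[symmetric] by (simp add: abs_less_iff)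
  qed
qed

section \<open>The scheme of a \<open>G\<close>-normal vector\<close>

text \<open>The stability property with \<open>a = b = 1\<close> and a linear function gives
  \<open>2 * m = sqrt 2 * m\<close> for its mean \<open>m\<close>, so \<open>m = 0\<close>.
  Functionals of either sign are covered.\<close>

lemma (in sublinear_expectation_space) G_normal_mean_zero:
  fixes Z :: "'w \<Rightarrow> real ^ 'd"
  assumes Z: "G_normal H E Z"
  shows "E (\<lambda>\<omega>. Z \<omega> $ k) = 0" and "E (\<lambda>\<omega>. - (Z \<omega> $ k)) = 0"
proof -
  have rv: "random_vector H Z" using Z by (simp add: G_normal_def)
  have law: "\<forall>a\<ge>0. \<forall>b\<ge>0. \<forall>\<phi>\<in>C_lLip norm.
      E (\<lambda>\<omega>. E (\<lambda>\<omega>'. \<phi> (a *\<^sub>R Z \<omega> + b *\<^sub>R Z \<omega>'))) = E (\<lambda>\<omega>. \<phi> (sqrt (a\<^sup>2 + b\<^sup>2) *\<^sub>R Z \<omega>))"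
    using Z by (simp add: G_normal_def)
  have gen: "E (\<lambda>\<omega>. p \<bullet> Z \<omega>) = 0" for p
  proof -
    have m: "(\<lambda>\<omega>. p \<bullet> Z \<omega>) \<in> H" by (rule comp_vector_mem[OF rv inner_C_lLip])
    have "E (\<lambda>\<omega>. E (\<lambda>\<omega>'. p \<bullet> (1 *\<^sub>R Z \<omega> + 1 *\<^sub>R Z \<omega>'))) = E (\<lambda>\<omega>. p \<bullet> (sqrt (1\<^sup>2 + 1\<^sup>2) *\<^sub>R Z \<omega>))"
      using law[rule_format, of 1 1 "\<lambda>z. p \<bullet> z"] inner_C_lLip[of p] by simp
    moreover have "E (\<lambda>\<omega>'. p \<bullet> (1 *\<^sub>R Z \<omega> + 1 *\<^sub>R Z \<omega>')) = p \<bullet> Z \<omega> + E (\<lambda>\<omega>. p \<bullet> Z \<omega>)" for \<omega>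
      using expectation_add_const[OF m, of "p \<bullet> Z \<omega>"] by (simp add: inner_add_right add.commute)
    moreover have "E (\<lambda>\<omega>. p \<bullet> (sqrt (1\<^sup>2 + 1\<^sup>2) *\<^sub>R Z \<omega>)) = sqrt 2 * E (\<lambda>\<omega>. p \<bullet> Z \<omega>)"
      using pos_hom[OF m, of "sqrt 2"] by simp
    ultimately have "2 * E (\<lambda>\<omega>. p \<bullet> Z \<omega>) = sqrt 2 * E (\<lambda>\<omega>. p \<bullet> Z \<omega>)"
      using expectation_add_const[OF m] by simp
    moreover have "sqrt 2 \<noteq> (2::real)" using real_sqrt_eq_iff[of 2 4] by simp
    ultimately show ?thesis by simp
  qed
  show "E (\<lambda>\<omega>. Z \<omega> $ k) = 0" using gen[of "axis k 1"] by (simp add: inner_axis')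
  show "E (\<lambda>\<omega>. - (Z \<omega> $ k)) = 0" using gen[of "- axis k 1"] by (simp add: inner_axis')
qed

lemma bounded_lipschitz_affine_C_lLip:
  fixes u :: "'a::real_normed_vector \<Rightarrow> real"
  assumes "u \<in> bounded_lipschitz M l"
  shows "(\<lambda>y. u (x + s *\<^sub>R y)) \<in> C_lLip norm"
proof (rule C_lLipI_lipschitz)
  show "\<bar>u (x + s *\<^sub>R y) - u (x + s *\<^sub>R z)\<bar> \<le> (l * \<bar>s\<bar>) * norm (y - z)" for y z
    using bounded_lipschitzD(2)[OF assms, of "x + s *\<^sub>R y" "x + s *\<^sub>R z"]
    by (simp add: scaleR_diff_right[symmetric] mult.assoc)
qed simp

text \<open>Squared scales add: one further step turns \<open>real n * s\<^sup>2\<close> into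
  \<open>real (Suc n) * s\<^sup>2\<close>. With \<open>s = 1 / sqrt (real n)\<close> and
  \<open>n > 0\<close>, the \<open>n\<close>-fold iterate is thus exactly one expectation.\<close>

lemma (in sublinear_expectation_space) G_normal_funpow:
  fixes Z :: "'w \<Rightarrow> real ^ 'd"
  assumes Z: "G_normal H E Z" and u: "u \<in> bounded_lipschitz M l" and s: "0 \<le> s"
  shows "(step_op E (\<lambda>\<omega>. s *\<^sub>R Z \<omega>) ^^ n) u x = E (\<lambda>\<omega>. u (x + (sqrt (real n) * s) *\<^sub>R Z \<omega>))"
proof (induction n arbitrary: x)
  case 0
  then show ?case by (simp add: const)
next
  case (Suc n)
  have law: "\<forall>a\<ge>0. \<forall>b\<ge>0. \<forall>\<phi>\<in>C_lLip norm.
      E (\<lambda>\<omega>. E (\<lambda>\<omega>'. \<phi> (a *\<^sub>R Z \<omega> + b *\<^sub>R Z \<omega>'))) = E (\<lambda>\<omega>. \<phi> (sqrt (a\<^sup>2 + b\<^sup>2) *\<^sub>R Z \<omega>))"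
    using Z by (simp add: G_normal_def)
  have "(step_op E (\<lambda>\<omega>. s *\<^sub>R Z \<omega>) ^^ Suc n) u x =
      E (\<lambda>\<omega>. E (\<lambda>\<omega>'. u (x + (s *\<^sub>R Z \<omega> + (sqrt (real n) * s) *\<^sub>R Z \<omega>'))))"
    by (simp add: step_op_def Suc add.assoc)
  also have "\<dots> = E (\<lambda>\<omega>. u (x + sqrt (s\<^sup>2 + (sqrt (real n) * s)\<^sup>2) *\<^sub>R Z \<omega>))"
    using law[rule_format, of s "sqrt (real n) * s" "\<lambda>y. u (x + y)"] s
      bounded_lipschitz_C_lLip[OF bounded_lipschitz_shift[OF u, of x]] by simp
  also have "s\<^sup>2 + (sqrt (real n) * s)\<^sup>2 = real (Suc n) * s\<^sup>2"
    by (simp add: power_mult_distrib algebra_simps)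
  also have "sqrt \<dots> = sqrt (real (Suc n)) * s" using s by (simp add: real_sqrt_mult)
  finally show ?case .
qed

section \<open>Independent sums\<close>

lemma C_lLip_shift:
  fixes \<psi> :: "'a::real_normed_vector \<Rightarrow> real"
  assumes "\<psi> \<in> C_lLip norm"
  shows "(\<lambda>x. \<psi> (y + x)) \<in> C_lLip norm"
proof -
  obtain C m where C: "C > 0" and
    b: "\<And>x z. \<bar>\<psi> x - \<psi> z\<bar> \<le> C * (1 + norm x ^ m + norm z ^ m) * norm (x - z)"
    using assms unfolding C_lLip_def by blast
  \<comment> \<open>From \<open>norm (y + x) ^ m \<le> 2 ^ m * (norm y ^ m + norm x ^ m)\<close>,
    used for \<open>x\<close> and for \<open>z\<close>; the dependence on the fixed \<open>y\<close>
    is harmless.\<close>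
  define D where "D = 1 + 2 ^ m + 2 * (2 ^ m * norm y ^ m)"
  have pw: "norm (y + x) ^ m \<le> 2 ^ m * norm y ^ m + 2 ^ m * norm x ^ m" for x
  proof -
    have "norm (y + x) ^ m \<le> (2 * max (norm y) (norm x)) ^ m"
      by (intro power_mono order_trans[OF norm_triangle_ineq]) auto
    also have "\<dots> \<le> 2 ^ m * (norm y ^ m + norm x ^ m)"
      by (auto simp: power_mult_distrib max_def)
    finally show ?thesis by (simp add: algebra_simps)
  qed
  have "\<bar>\<psi> (y + x) - \<psi> (y + z)\<bar> \<le> (C * D) * (1 + norm x ^ m + norm z ^ m) * norm (x - z)" for x z
  proof -
    have "1 + norm (y + x) ^ m + norm (y + z) ^ m \<le>
        (1 + 2 * (2 ^ m * norm y ^ m)) * 1 + 2 ^ m * (norm x ^ m + norm z ^ m)"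
      using pw[of x] pw[of z] by (simp add: algebra_simps)
    also have "\<dots> \<le> D * 1 + D * (norm x ^ m + norm z ^ m)"
      unfolding D_def by (intro add_mono mult_right_mono) auto
    finally have "C * (1 + norm (y + x) ^ m + norm (y + z) ^ m) \<le> C * (D * (1 + norm x ^ m + norm z ^ m))"
      using C by (intro mult_left_mono) (auto simp: algebra_simps)
    from mult_right_mono[OF this, of "norm (x - z)"] show ?thesis
      using b[of "y + x" "y + z"] by (simp add: mult.assoc)
  qed
  moreover have "C * D > 0" using C by (simp add: D_def add_pos_nonneg)
  ultimately show ?thesis unfolding C_lLip_def by blast
qed

text \<open>Independence is stated for the whole tuple of past variables; this makes functions of
  their sum and the next variable admissible test functions.\<close>

lemma partial_sum_C_lLip:
  fixes \<psi> :: "'a::real_normed_vector \<Rightarrow> real"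
  assumes "\<psi> \<in> C_lLip norm"
  shows "(\<lambda>z. \<psi> ((\<Sum>j\<in>{1..n}. fst z j) + snd z)) \<in> C_lLip (pair_norm (tuple_norm {1..n}) norm)"
proof (rule C_lLip_comp_le[OF assms, where c = "real n + 1"])
  fix z w :: "(nat \<Rightarrow> 'a) \<times> 'a"
  define N where "N = pair_norm (tuple_norm {1..n}) norm z"
  have "tuple_norm {1..n} (fst z) \<le> N" "norm (snd z) \<le> N"
    using real_sqrt_sum_squares_ge1[of "tuple_norm {1..n} (fst z)" "norm (snd z)"]
      real_sqrt_sum_squares_ge2[of "norm (snd z)" "tuple_norm {1..n} (fst z)"]
    by (simp_all add: N_def pair_norm_def tuple_norm_def)
  moreover have "norm (fst z j) \<le> tuple_norm {1..n} (fst z)" if "j \<in> {1..n}" for j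
    unfolding tuple_norm_def using that member_le_L2_set[of "{1..n}" j "\<lambda>j. norm (fst z j)"] by simp
  ultimately have "norm (fst z j) \<le> N" if "j \<in> {1..n}" for j
    using that order_trans by blast
  then have "norm (\<Sum>j\<in>{1..n}. fst z j) \<le> real (card {1..n}) * N" by (rule sum_norm_bound)
  then have "norm (\<Sum>j\<in>{1..n}. fst z j) \<le> real n * N" by simp
  then show "norm ((\<Sum>j\<in>{1..n}. fst z j) + snd z) \<le> (real n + 1) * pair_norm (tuple_norm {1..n}) norm z"
    using norm_triangle_ineq[of "\<Sum>j\<in>{1..n}. fst z j" "snd z"] \<open>norm (snd z) \<le> N\<close>
    by (simp add: N_def algebra_simps)
  show "(\<Sum>j\<in>{1..n}. fst z j) + snd z - ((\<Sum>j\<in>{1..n}. fst w j) + snd w) =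
      (\<Sum>j\<in>{1..n}. fst (z - w) j) + snd (z - w)"
    by (simp add: sum_subtractf)
  show "0 \<le> pair_norm (tuple_norm {1..n}) norm z" by (simp add: pair_norm_def)
qed auto

locale iid_sequence = sublinear_expectation_space H E
  for H :: "('w \<Rightarrow> real) set" and E :: "('w \<Rightarrow> real) \<Rightarrow> real" +
  fixes X :: "nat \<Rightarrow> 'w \<Rightarrow> real ^ 'd"
  assumes rv: "i \<ge> 1 \<Longrightarrow> random_vector H (X i)"
    and same_law: "i \<ge> 1 \<Longrightarrow> identically_distributed E (X (i + 1)) E (X i)"
    and indep: "i \<ge> 1 \<Longrightarrow>
           independent_from E norm (X (i + 1)) (tuple_norm {1..i}) (\<lambda>\<omega> j. X j \<omega>)"
begin

definition S :: "nat \<Rightarrow> 'w \<Rightarrow> real ^ 'd" where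
  "S n \<omega> = (\<Sum>i=1..n. X i \<omega>)"

lemma random_vector_S: "random_vector H (S n)"
  unfolding S_def[abs_def] by (intro random_vector_sum rv) auto

lemma law_eq_first:
  assumes "\<psi> \<in> C_lLip norm"
  shows "E (\<lambda>\<omega>. \<psi> (X (Suc n) \<omega>)) = E (\<lambda>\<omega>. \<psi> (X 1 \<omega>))"
proof (induction n)
  case (Suc n)
  then show ?case using same_law[of "Suc n"] assms by (simp add: identically_distributed_def)
qed simp

text \<open>Independence freezes the past sum at a value \<open>y\<close>; with \<open>y\<close>
  fixed the last variable may be replaced by \<open>X 1\<close>, as it has the same law.\<close>

lemma expectation_S_Suc:
  assumes "\<psi> \<in> C_lLip norm"
  shows "E (\<lambda>\<omega>. \<psi> (S (Suc n) \<omega>)) = E (\<lambda>\<omega>. E (\<lambda>\<omega>'. \<psi> (S n \<omega> + X 1 \<omega>')))"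
\<comment> \<open>Independence is assumed from index 1 on; for \<open>n = 0\<close> the past sum is
  0 and the outer expectation is that of a constant.\<close>
proof (cases "n = 0")
  case True
  then show ?thesis by (simp add: S_def const)
next
  case False
  then have "independent_from E norm (X (n + 1)) (tuple_norm {1..n}) (\<lambda>\<omega> j. X j \<omega>)"
    by (intro indep) simp
  from this[unfolded independent_from_def, rule_format, OF partial_sum_C_lLip[OF assms]]
  have "E (\<lambda>\<omega>. \<psi> (S (Suc n) \<omega>)) = E (\<lambda>\<omega>. E (\<lambda>\<omega>'. \<psi> (S n \<omega> + X (Suc n) \<omega>')))"
    by (simp add: S_def)
  moreover have "E (\<lambda>\<omega>'. \<psi> (y + X (Suc n) \<omega>')) = E (\<lambda>\<omega>'. \<psi> (y + X 1 \<omega>'))" for y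
    by (rule law_eq_first[OF C_lLip_shift[OF assms]])
  ultimately show ?thesis by simp
qed

text \<open>The last summand is integrated first and turns \<open>u\<close> into its image under one
  step. Therefore the induction runs over all bounded Lipschitz \<open>u\<close>.\<close>

lemma expectation_scaled_S:
  assumes "u \<in> bounded_lipschitz M l"
  shows "E (\<lambda>\<omega>. u (s *\<^sub>R S n \<omega>)) = (step_op E (\<lambda>\<omega>. s *\<^sub>R X 1 \<omega>) ^^ n) u 0"
  using assms
proof (induction n arbitrary: u)
  case 0
  then show ?case by (simp add: S_def const)
next
  case (Suc n)
  have "(\<lambda>y. u (s *\<^sub>R y)) \<in> C_lLip norm"
    using bounded_lipschitz_affine_C_lLip[OF Suc.prems, of 0 s] by simp
  then have "E (\<lambda>\<omega>. u (s *\<^sub>R S (Suc n) \<omega>)) = E (\<lambda>\<omega>. step_op E (\<lambda>\<omega>. s *\<^sub>R X 1 \<omega>) u (s *\<^sub>R S n \<omega>))"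
    using expectation_S_Suc[of "\<lambda>y. u (s *\<^sub>R y)" n] by (simp add: step_op_def scaleR_add_right)
  also have "\<dots> = (step_op E (\<lambda>\<omega>. s *\<^sub>R X 1 \<omega>) ^^ n) (step_op E (\<lambda>\<omega>. s *\<^sub>R X 1 \<omega>) u) 0"
    by (intro Suc.IH step_op_bounded_lipschitz[OF _ Suc.prems] random_vector_scale rv) simp
  finally show ?case by (simp add: funpow_swap1)
qed

text \<open>The cross term is linear in \<open>X 1\<close> and has no mean uncertainty, so second
  moments add exactly. Hence the normalised sums have second moments independent of
  \<open>n \<ge> 1\<close>.\<close>

lemma expectation_norm_sq_S:
  assumes "\<And>k. E (\<lambda>\<omega>. X 1 \<omega> $ k) = 0" "\<And>k. E (\<lambda>\<omega>. - (X 1 \<omega> $ k)) = 0"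
  shows "E (\<lambda>\<omega>. (norm (S n \<omega>))\<^sup>2) = real n * E (\<lambda>\<omega>. (norm (X 1 \<omega>))\<^sup>2)"
proof (induction n)
  case 0
  then show ?case by (simp add: S_def const)
next
  case (Suc n)
  have X1: "random_vector H (X 1)" by (rule rv) simp
  note m = comp_vector_mem[OF X1 norm_sq_C_lLip]
  have "E (\<lambda>\<omega>'. (norm (y + X 1 \<omega>'))\<^sup>2) = (norm y)\<^sup>2 + E (\<lambda>\<omega>. (norm (X 1 \<omega>))\<^sup>2)" for y
  proof -
    have "E (\<lambda>\<omega>'. (norm (y + X 1 \<omega>'))\<^sup>2) = E (\<lambda>\<omega>. (2 *\<^sub>R y) \<bullet> X 1 \<omega> + ((norm (X 1 \<omega>))\<^sup>2 + (norm y)\<^sup>2))"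
      by (simp add: power2_norm_eq_inner inner_add_left inner_add_right inner_commute algebra_simps)
    also have "\<dots> = E (\<lambda>\<omega>. (norm (X 1 \<omega>))\<^sup>2 + (norm y)\<^sup>2)"
      by (rule expectation_add_inner[OF X1 assms add_mem[OF m const_mem]])
    also have "\<dots> = (norm y)\<^sup>2 + E (\<lambda>\<omega>. (norm (X 1 \<omega>))\<^sup>2)"
      using expectation_add_const[OF m] by simp
    finally show ?thesis .
  qed
  then have "E (\<lambda>\<omega>. (norm (S (Suc n) \<omega>))\<^sup>2) = E (\<lambda>\<omega>. (norm (S n \<omega>))\<^sup>2 + E (\<lambda>\<omega>. (norm (X 1 \<omega>))\<^sup>2))"
    using expectation_S_Suc[OF norm_sq_C_lLip, of n] by simp
  also have "\<dots> = E (\<lambda>\<omega>. (norm (S n \<omega>))\<^sup>2) + E (\<lambda>\<omega>. (norm (X 1 \<omega>))\<^sup>2)"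
    by (rule expectation_add_const[OF comp_vector_mem[OF random_vector_S norm_sq_C_lLip]])
  finally show ?case by (simp add: Suc algebra_simps)
qed

lemma central_limit_bounded_lipschitz:
  fixes Z :: "'v \<Rightarrow> real ^ 'd"
  assumes mean: "\<And>k. E (\<lambda>\<omega>. X 1 \<omega> $ k) = 0" "\<And>k. E (\<lambda>\<omega>. - (X 1 \<omega> $ k)) = 0"
    and E': "sublinear_expectation_space H' E'" and Z: "G_normal H' E' Z"
    and G: "\<And>A. transpose A = A \<Longrightarrow> G_function E' Z A = G_function E (X 1) A"
    and u: "u \<in> bounded_lipschitz M l"
  shows "(\<lambda>n. E (\<lambda>\<omega>. u ((1 / sqrt (real n)) *\<^sub>R S n \<omega>))) \<longlonglongrightarrow> E' (\<lambda>\<omega>. u (Z \<omega>))"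
proof -
  interpret E': sublinear_expectation_space H' E' by (rule E')
  have X1: "random_vector H (X 1)" by (rule rv) simp
  have rZ: "random_vector H' Z" using Z by (simp add: G_normal_def)
  have "(\<lambda>n. E (\<lambda>\<omega>. u ((1 / sqrt (real n)) *\<^sub>R S n \<omega>))
      - (step_op E' (\<lambda>\<omega>. (1 / sqrt (real n)) *\<^sub>R Z \<omega>) ^^ n) u 0) \<longlonglongrightarrow> 0"
    unfolding expectation_scaled_S[OF u]
    by (rule funpow_step_op_diff_tendsto_0[OF sublinear_expectation_space_axioms E' X1 rZ mean
          E'.G_normal_mean_zero[OF Z] G u])
  moreover have "eventually (\<lambda>n. (step_op E' (\<lambda>\<omega>. (1 / sqrt (real n)) *\<^sub>R Z \<omega>) ^^ n) u 0
      = E' (\<lambda>\<omega>. u (Z \<omega>))) sequentially"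
    using eventually_gt_at_top[of 0] by eventually_elim (simp add: E'.G_normal_funpow[OF Z u])
  ultimately have "(\<lambda>n. E (\<lambda>\<omega>. u ((1 / sqrt (real n)) *\<^sub>R S n \<omega>)) - E' (\<lambda>\<omega>. u (Z \<omega>))) \<longlonglongrightarrow> 0"
    by (rule Lim_transform_eventually[OF _ eventually_mono]) auto
  then show ?thesis by (simp add: LIM_zero_iff)
qed

end

section \<open>Functions of linear growth\<close>

text \<open>The definite description denotes a limit only once existence and uniqueness are shown:
  the first is a Cauchy argument, the second compares two approximating sequences. The error bound
  makes the extension quantitative.\<close>

lemma (in sublinear_expectation_space) ext_expectation_approx:
  fixes X :: "'w \<Rightarrow> real ^ 'd"
  assumes X: "random_vector H X"
    and f: "\<And>k. f k \<in> C_lLip norm" and g: "\<And>k. g k \<in> C_lLip norm"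
    and fg: "\<And>k x. \<bar>\<phi> x - f k x\<bar> \<le> g k x"
    and g0: "(\<lambda>k. E (\<lambda>\<omega>. g k (X \<omega>))) \<longlonglongrightarrow> 0"
  shows "\<bar>ext_expectation E \<phi> X - E (\<lambda>\<omega>. f k (X \<omega>))\<bar> \<le> E (\<lambda>\<omega>. g k (X \<omega>))"
proof -
  have diff: "\<bar>E (\<lambda>\<omega>. p (X \<omega>)) - E (\<lambda>\<omega>. q (X \<omega>))\<bar> \<le> E (\<lambda>\<omega>. p' (X \<omega>)) + E (\<lambda>\<omega>. q' (X \<omega>))"
    if "p \<in> C_lLip norm" "q \<in> C_lLip norm" "p' \<in> C_lLip norm" "q' \<in> C_lLip norm"
      "\<And>x. \<bar>\<phi> x - p x\<bar> \<le> p' x" "\<And>x. \<bar>\<phi> x - q x\<bar> \<le> q' x" for p q p' q'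
  proof -
    note m = comp_vector_mem[OF X]
    have "\<bar>p x - q x\<bar> \<le> p' x + q' x" for x using that(5,6)[of x] by linarith
    then have "\<bar>E (\<lambda>\<omega>. p (X \<omega>)) - E (\<lambda>\<omega>. q (X \<omega>))\<bar> \<le> E (\<lambda>\<omega>. p' (X \<omega>) + q' (X \<omega>))"
      by (intro expectation_diff_le add_mem m that)
    also have "\<dots> \<le> E (\<lambda>\<omega>. p' (X \<omega>)) + E (\<lambda>\<omega>. q' (X \<omega>))" by (intro subadd m that)
    finally show ?thesis .
  qed
  have "Cauchy (\<lambda>k. E (\<lambda>\<omega>. f k (X \<omega>)))"
  proof (rule metric_CauchyI)
    fix e :: real
    assume "0 < e"
    then have "eventually (\<lambda>k. E (\<lambda>\<omega>. g k (X \<omega>)) < e / 2) sequentially"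
      by (intro order_tendstoD(2)[OF g0]) simp
    then obtain N where N: "\<And>k. k \<ge> N \<Longrightarrow> E (\<lambda>\<omega>. g k (X \<omega>)) < e / 2"
      by (auto simp: eventually_sequentially)
    have "dist (E (\<lambda>\<omega>. f i (X \<omega>))) (E (\<lambda>\<omega>. f j (X \<omega>))) < e" if "i \<ge> N" "j \<ge> N" for i j
      using diff[OF f[of i] f[of j] g[of i] g[of j] fg fg] N[OF that(1)] N[OF that(2)]
      by (simp add: dist_real_def)
    then show "\<exists>N. \<forall>i\<ge>N. \<forall>j\<ge>N. dist (E (\<lambda>\<omega>. f i (X \<omega>))) (E (\<lambda>\<omega>. f j (X \<omega>))) < e" by blast
  qed
  then obtain L where L: "(\<lambda>k. E (\<lambda>\<omega>. f k (X \<omega>))) \<longlonglongrightarrow> L"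
    using Cauchy_convergent convergent_def by blast
  have "ext_expectation E \<phi> X = L"
    unfolding ext_expectation_def
  proof (rule the_equality)
    show "\<exists>f g. (\<forall>k. f k \<in> C_lLip norm \<and> g k \<in> C_lLip norm \<and> (\<forall>x. \<bar>\<phi> x - f k x\<bar> \<le> g k x)) \<and>
        (\<lambda>k. E (\<lambda>\<omega>. g k (X \<omega>))) \<longlonglongrightarrow> 0 \<and> (\<lambda>k. E (\<lambda>\<omega>. f k (X \<omega>))) \<longlonglongrightarrow> L"
      using f g fg g0 L by blast
  next
    fix L'
    assume "\<exists>f g. (\<forall>k. f k \<in> C_lLip norm \<and> g k \<in> C_lLip norm \<and> (\<forall>x. \<bar>\<phi> x - f k x\<bar> \<le> g k x)) \<and>
        (\<lambda>k. E (\<lambda>\<omega>. g k (X \<omega>))) \<longlonglongrightarrow> 0 \<and> (\<lambda>k. E (\<lambda>\<omega>. f k (X \<omega>))) \<longlonglongrightarrow> L'"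
    then obtain f' g' where f': "\<And>k. f' k \<in> C_lLip norm" "\<And>k. g' k \<in> C_lLip norm"
      "\<And>k x. \<bar>\<phi> x - f' k x\<bar> \<le> g' k x" "(\<lambda>k. E (\<lambda>\<omega>. g' k (X \<omega>))) \<longlonglongrightarrow> 0"
      "(\<lambda>k. E (\<lambda>\<omega>. f' k (X \<omega>))) \<longlonglongrightarrow> L'" by blast
    have "(\<lambda>k. E (\<lambda>\<omega>. f' k (X \<omega>)) - E (\<lambda>\<omega>. f k (X \<omega>))) \<longlonglongrightarrow> 0"
    proof (rule Lim_null_comparison)
      show "(\<lambda>k. E (\<lambda>\<omega>. g' k (X \<omega>)) + E (\<lambda>\<omega>. g k (X \<omega>))) \<longlonglongrightarrow> 0"
        using tendsto_add[OF f'(4) g0] by simp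
      show "eventually (\<lambda>k. norm (E (\<lambda>\<omega>. f' k (X \<omega>)) - E (\<lambda>\<omega>. f k (X \<omega>)))
          \<le> E (\<lambda>\<omega>. g' k (X \<omega>)) + E (\<lambda>\<omega>. g k (X \<omega>))) sequentially"
        using diff[OF f'(1) f f'(2) g f'(3) fg] by simp
    qed
    moreover have "(\<lambda>k. E (\<lambda>\<omega>. f' k (X \<omega>)) - E (\<lambda>\<omega>. f k (X \<omega>))) \<longlonglongrightarrow> L' - L"
      by (intro tendsto_diff f'(5) L)
    ultimately have "L' - L = 0" using LIMSEQ_unique by blast
    then show "L' = L" by simp
  qed
  \<comment> \<open>The estimate between the indices \<open>j\<close> and \<open>k\<close> is passed
    to the limit in \<open>j\<close>; the term of \<open>g j\<close> vanishes.\<close>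
  moreover have "\<bar>L - E (\<lambda>\<omega>. f k (X \<omega>))\<bar> \<le> E (\<lambda>\<omega>. g k (X \<omega>)) + 0"
  proof (rule LIMSEQ_le)
    show "(\<lambda>j. \<bar>E (\<lambda>\<omega>. f j (X \<omega>)) - E (\<lambda>\<omega>. f k (X \<omega>))\<bar>) \<longlonglongrightarrow> \<bar>L - E (\<lambda>\<omega>. f k (X \<omega>))\<bar>"
      by (intro tendsto_intros L)
    show "(\<lambda>j. E (\<lambda>\<omega>. g k (X \<omega>)) + E (\<lambda>\<omega>. g j (X \<omega>))) \<longlonglongrightarrow> E (\<lambda>\<omega>. g k (X \<omega>)) + 0"
      by (intro tendsto_intros g0)
    show "\<exists>N. \<forall>j\<ge>N. \<bar>E (\<lambda>\<omega>. f j (X \<omega>)) - E (\<lambda>\<omega>. f k (X \<omega>))\<bar>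
        \<le> E (\<lambda>\<omega>. g k (X \<omega>)) + E (\<lambda>\<omega>. g j (X \<omega>))"
      using diff[OF f f[of k] g g[of k] fg fg] by (simp add: add.commute)
  qed
  ultimately show ?thesis by simp
qed

text \<open>Inf-convolution with \<open>l * norm\<close> (the Pasch-Hausdorff envelope): an infimum
  of \<open>l\<close>-Lipschitz functions is \<open>l\<close>-Lipschitz.\<close>

lemma bounded_lipschitz_approximation:
  fixes \<psi> :: "'a::real_normed_vector \<Rightarrow> real"
  assumes uc: "uniformly_continuous_on UNIV \<psi>" and M: "\<And>x. \<bar>\<psi> x\<bar> \<le> M" and e: "0 < e"
  obtains f l where "f \<in> bounded_lipschitz M l" "\<And>x. \<bar>\<psi> x - f x\<bar> \<le> e"
proof -
  have M0: "0 \<le> M" using M[of 0] by simp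
  obtain d where d: "0 < d" "\<And>x y. dist y x < d \<Longrightarrow> dist (\<psi> y) (\<psi> x) < e"
    using uc e unfolding uniformly_continuous_on_def by blast
  \<comment> \<open>At distance at least \<open>d\<close> the penalty is at least
    \<open>2 * M\<close>, the largest possible oscillation; closer points are handled by uniform
    continuity.\<close>
  define l where "l = 2 * M / d"
  have l: "0 \<le> l" using M0 d by (simp add: l_def)
  define f where "f x = (INF y. \<psi> y + l * norm (x - y))" for x
  have low: "- M \<le> \<psi> y + l * norm (x - y)" for x y
    using M[of y] mult_nonneg_nonneg[OF l norm_ge_zero[of "x - y"]] by linarith
  have bdd: "bdd_below (range (\<lambda>y. \<psi> y + l * norm (x - y)))" for x
    using low by (intro bdd_belowI[of _ "- M"]) auto
  have upper: "f x \<le> \<psi> y + l * norm (x - y)" for x y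
    unfolding f_def by (intro cINF_lower bdd) auto
  have lower: "c \<le> f x" if "\<And>y. c \<le> \<psi> y + l * norm (x - y)" for c x
    unfolding f_def using that by (intro cINF_greatest) auto
  have lip: "f x \<le> f y + l * norm (x - y)" for x y
  proof -
    have "f x - l * norm (x - y) \<le> \<psi> z + l * norm (y - z)" for z
    proof -
      have "l * norm (x - z) \<le> l * (norm (x - y) + norm (y - z))"
        using norm_triangle_ineq[of "x - y" "y - z"] by (intro mult_left_mono l) simp
      then show ?thesis using upper[of x z] by (simp add: distrib_left)
    qed
    then have "f x - l * norm (x - y) \<le> f y" by (rule lower)
    then show ?thesis by simp
  qed
  show thesis
  proof
    show "f \<in> bounded_lipschitz M l"
    proof (rule bounded_lipschitzI)
      show "\<bar>f x\<bar> \<le> M" for x using lower[OF low, of x] upper[of x x] M[of x] by simp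
      show "\<bar>f x - f y\<bar> \<le> l * norm (x - y)" for x y
        using lip[of x y] lip[of y x] by (simp add: norm_minus_commute)
    qed
    fix x
    have "\<psi> x - e \<le> \<psi> y + l * norm (x - y)" for y
    proof (cases "dist y x < d")
      case True
      then show ?thesis
        using d(2)[OF True] mult_nonneg_nonneg[OF l norm_ge_zero[of "x - y"]]
        by (simp add: dist_real_def abs_less_iff)
    next
      case False
      then have "l * d \<le> l * norm (x - y)"
        by (intro mult_left_mono l) (simp add: dist_norm norm_minus_commute)
      moreover have "l * d = 2 * M" using d by (simp add: l_def)
      ultimately show ?thesis using M[of x] M[of y] e by linarith
    qed
    then have "\<psi> x - e \<le> f x" by (rule lower)
    then show "\<bar>\<psi> x - f x\<bar> \<le> e" using upper[of x x] e by simp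
  qed
qed

text \<open>Composing with the projection onto a ball makes \<open>\<phi>\<close> bounded and
  uniformly continuous. Outside the ball the quadratic weight exceeds linear growth by a factor of
  order \<open>R\<close>.\<close>

lemma linear_growth_approximation:
  fixes \<phi> :: "'a::euclidean_space \<Rightarrow> real"
  assumes c: "continuous_on UNIV \<phi>" and growth: "\<And>x. \<bar>\<phi> x\<bar> \<le> C * (1 + norm x)" and R: "1 \<le> R"
  obtains f M l where "f \<in> bounded_lipschitz M l"
    "\<And>x. \<bar>\<phi> x - f x\<bar> \<le> (4 * C + 1) / R * (1 + (norm x)\<^sup>2)"
proof -
  have C: "0 \<le> C" using growth[of 0] by simp
  define p where "p = closest_point (cball (0::'a) R)"
  have p: "p x \<in> cball 0 R" for x unfolding p_def using R by (intro closest_point_in_set) auto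
  have pid: "p x = x" if "norm x \<le> R" for x unfolding p_def using that by (intro closest_point_self) simp
  have plip: "dist (p x) (p y) \<le> dist x y" for x y
    unfolding p_def using R by (intro closest_point_lipschitz) auto
  have "uniformly_continuous_on (cball 0 R) \<phi>"
    by (intro compact_uniformly_continuous continuous_on_subset[OF c]) auto
  then have uc: "uniformly_continuous_on UNIV (\<lambda>x. \<phi> (p x))"
    unfolding uniformly_continuous_on_def using p plip by (meson UNIV_I le_less_trans)
  have bd: "\<bar>\<phi> (p x)\<bar> \<le> C * (1 + R)" for x
    using growth[of "p x"] mult_left_mono[OF _ C, of "1 + norm (p x)" "1 + R"] p[of x] by simp
  obtain f l where f: "f \<in> bounded_lipschitz (C * (1 + R)) l" "\<And>x. \<bar>\<phi> (p x) - f x\<bar> \<le> 1 / R"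
    using bounded_lipschitz_approximation[OF uc bd, of "1 / R"] R by auto
  have "\<bar>\<phi> x - f x\<bar> \<le> (4 * C + 1) / R * (1 + (norm x)\<^sup>2)" for x
  proof -
    \<comment> \<open>Outside the ball \<open>1 \<le> R < norm x\<close>, so
      \<open>1 + norm x\<close> and \<open>1 + R\<close> are both at most \<open>2 * norm x\<close>,
      and the factor \<open>norm x / R\<close> exceeds 1.\<close>
    have "\<bar>\<phi> x - \<phi> (p x)\<bar> \<le> 4 * C * (norm x)\<^sup>2 / R"
    proof (cases "norm x \<le> R")
      case True
      then show ?thesis using pid[OF True] C R by simp
    next
      case False
      have "\<bar>\<phi> x - \<phi> (p x)\<bar> \<le> C * (1 + norm x) + C * (1 + R)" using growth[of x] bd[of x] by linarith
      also have "\<dots> \<le> C * (2 * norm x) + C * (2 * norm x)"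
        using False R by (intro add_mono mult_left_mono C) auto
      also have "\<dots> = 4 * C * norm x * 1" by simp
      also have "\<dots> \<le> 4 * C * norm x * (norm x / R)"
        using False R C by (intro mult_left_mono) auto
      finally show ?thesis by (simp add: power2_eq_square mult.assoc)
    qed
    then have "\<bar>\<phi> x - f x\<bar> \<le> 4 * C * (norm x)\<^sup>2 / R + 1 / R" using f(2)[of x] by linarith
    also have "\<dots> = (4 * C * (norm x)\<^sup>2 + 1) / R" by (simp add: add_divide_distrib)
    also have "\<dots> \<le> ((4 * C + 1) * (1 + (norm x)\<^sup>2)) / R"
      using R C by (intro divide_right_mono) (auto simp: algebra_simps)
    finally show ?thesis by simp
  qed
  with f(1) show thesis by (rule that)
qed

lemma quadratic_weight_C_lLip:
  "(\<lambda>x::'a::real_normed_vector. c * (1 + (norm x)\<^sup>2)) \<in> C_lLip norm"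
proof -
  obtain C m where C: "C > 0" and
    b: "\<And>x y::'a. \<bar>(norm x)\<^sup>2 - (norm y)\<^sup>2\<bar> \<le> C * (1 + norm x ^ m + norm y ^ m) * norm (x - y)"
    using norm_sq_C_lLip[where 'a = 'a] unfolding C_lLip_def by blast
  have "\<bar>c * (1 + (norm x)\<^sup>2) - c * (1 + (norm y)\<^sup>2)\<bar>
      \<le> ((\<bar>c\<bar> + 1) * C) * (1 + norm x ^ m + norm y ^ m) * norm (x - y)" for x y :: 'a
  proof -
    have "\<bar>c * (1 + (norm x)\<^sup>2) - c * (1 + (norm y)\<^sup>2)\<bar> = \<bar>c\<bar> * \<bar>(norm x)\<^sup>2 - (norm y)\<^sup>2\<bar>"
      by (simp add: right_diff_distrib[symmetric] abs_mult)
    also have "\<dots> \<le> (\<bar>c\<bar> + 1) * (C * (1 + norm x ^ m + norm y ^ m) * norm (x - y))"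
      by (intro mult_mono b) auto
    finally show ?thesis by (simp add: mult.assoc)
  qed
  moreover have "(\<bar>c\<bar> + 1) * C > 0" using C by simp
  ultimately show ?thesis unfolding C_lLip_def by blast
qed

lemma (in sublinear_expectation_space) expectation_quadratic_weight:
  assumes "random_vector H X" "0 \<le> c"
  shows "E (\<lambda>\<omega>. c * (1 + (norm (X \<omega>))\<^sup>2)) = c * (1 + E (\<lambda>\<omega>. (norm (X \<omega>))\<^sup>2))"
proof -
  note m = comp_vector_mem[OF assms(1) norm_sq_C_lLip]
  have "E (\<lambda>\<omega>. c * ((norm (X \<omega>))\<^sup>2 + 1)) = c * (E (\<lambda>\<omega>. (norm (X \<omega>))\<^sup>2) + 1)"
    using pos_hom[OF add_mem[OF m const_mem[of 1]] assms(2)] expectation_add_const[OF m, of 1] by simp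
  then show ?thesis by (simp add: add.commute)
qed

theorem theorem3p3:
  fixes H :: "('w \<Rightarrow> real) set" and E :: "('w \<Rightarrow> real) \<Rightarrow> real"
    and H' :: "('v \<Rightarrow> real) set" and E' :: "('v \<Rightarrow> real) \<Rightarrow> real"
    and X :: "nat \<Rightarrow> 'w \<Rightarrow> real ^ 'd" and Z :: "'v \<Rightarrow> real ^ 'd"
    and \<phi> :: "real ^ 'd \<Rightarrow> real"
  assumes "sublinear_expectation_space H E"
    and "\<And>i. i \<ge> 1 \<Longrightarrow> random_vector H (X i)"
    and "\<And>i. i \<ge> 1 \<Longrightarrow> identically_distributed E (X (i + 1)) E (X i)"
    and "\<And>i. i \<ge> 1 \<Longrightarrow>
           independent_from E norm (X (i + 1)) (tuple_norm {1..i}) (\<lambda>\<omega> j. X j \<omega>)"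
    and "vec_expectation E (X 1) = 0" and "vec_expectation E (\<lambda>\<omega>. - X 1 \<omega>) = 0"
    and "sublinear_expectation_space H' E'"
    and "G_normal H' E' Z"
    and "\<And>A. transpose A = A \<Longrightarrow> G_function E' Z A = G_function E (X 1) A"
    and "continuous_on UNIV \<phi>"
    and "\<exists>C. \<forall>x. \<bar>\<phi> x\<bar> \<le> C * (1 + norm x)"
  shows "(\<lambda>n. ext_expectation E \<phi> (\<lambda>\<omega>. (1 / sqrt (real n)) *\<^sub>R (\<Sum>i=1..n. X i \<omega>)))
           \<longlonglongrightarrow> ext_expectation E' \<phi> Z"
proof -
  interpret iid_sequence H E X
    using assms(1-4) by (intro iid_sequence.intro iid_sequence_axioms.intro)
  interpret E': sublinear_expectation_space H' E' by (rule assms(7))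
  have mean: "E (\<lambda>\<omega>. X 1 \<omega> $ k) = 0" "E (\<lambda>\<omega>. - (X 1 \<omega> $ k)) = 0" for k
    using assms(5,6) by (simp_all add: vec_expectation_def vec_eq_iff)
  have rZ: "random_vector H' Z" using assms(8) by (simp add: G_normal_def)
  obtain C where growth: "\<And>x. \<bar>\<phi> x\<bar> \<le> C * (1 + norm x)" using assms(11) by blast
  have C: "0 \<le> C" using growth[of 0] by simp
  have "\<exists>f. (\<exists>M l. f \<in> bounded_lipschitz M l) \<and>
      (\<forall>x. \<bar>\<phi> x - f x\<bar> \<le> (4 * C + 1) / real (Suc k) * (1 + (norm x)\<^sup>2))" for k
    by (rule linear_growth_approximation[OF assms(10) growth, of "real (Suc k)"]) (simp, blast)
  then obtain f where fb: "\<And>k. \<exists>M l. f k \<in> bounded_lipschitz M l"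
    and f: "\<And>k x. \<bar>\<phi> x - f k x\<bar> \<le> (4 * C + 1) / real (Suc k) * (1 + (norm x)\<^sup>2)"
    by metis
  have fC: "f k \<in> C_lLip norm" for k using fb[of k] bounded_lipschitz_C_lLip by blast
  define c where "c k = (4 * C + 1) / real (Suc k)" for k
  have c: "0 \<le> c k" for k using C by (simp add: c_def)
  have c0: "(\<lambda>k. c k * K) \<longlonglongrightarrow> 0" for K
  proof -
    have "(\<lambda>k. (4 * C + 1) * inverse (real (Suc k)) * K) \<longlonglongrightarrow> (4 * C + 1) * 0 * K"
      by (intro tendsto_mult tendsto_const LIMSEQ_inverse_real_of_nat)
    then show ?thesis by (simp add: c_def divide_inverse)
  qed
  note f = f[folded c_def]
  define T where "T n \<omega> = (1 / sqrt (real n)) *\<^sub>R S n \<omega>" for n \<omega>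
  have rT: "random_vector H (T n)" for n
    unfolding T_def[abs_def] by (rule random_vector_scale[OF random_vector_S])
  define K where "K = 1 + E (\<lambda>\<omega>. (norm (X 1 \<omega>))\<^sup>2)"
  define K' where "K' = 1 + E' (\<lambda>\<omega>. (norm (Z \<omega>))\<^sup>2)"
  \<comment> \<open>The right-hand side is free of \<open>n\<close>; \<open>n \<ge> 1\<close> is
    needed to cancel \<open>real n\<close>.\<close>
  have T2: "E (\<lambda>\<omega>. c k * (1 + (norm (T n \<omega>))\<^sup>2)) = c k * K" if "n \<ge> 1" for n k
  proof -
    have "E (\<lambda>\<omega>. (norm (T n \<omega>))\<^sup>2) = E (\<lambda>\<omega>. (1 / real n) * (norm (S n \<omega>))\<^sup>2)"
      by (simp add: T_def power_divide)
    also have "\<dots> = (1 / real n) * E (\<lambda>\<omega>. (norm (S n \<omega>))\<^sup>2)"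
      by (intro pos_hom comp_vector_mem[OF random_vector_S norm_sq_C_lLip]) simp
    also have "\<dots> = E (\<lambda>\<omega>. (norm (X 1 \<omega>))\<^sup>2)"
      using that by (simp add: expectation_norm_sq_S[OF mean])
    finally show ?thesis using expectation_quadratic_weight[OF rT c, of k n] by (simp add: K_def)
  qed
  have Z2: "E' (\<lambda>\<omega>. c k * (1 + (norm (Z \<omega>))\<^sup>2)) = c k * K'" for k
    using E'.expectation_quadratic_weight[OF rZ c] by (simp add: K'_def)
  have extT: "\<bar>ext_expectation E \<phi> (T n) - E (\<lambda>\<omega>. f k (T n \<omega>))\<bar> \<le> c k * K" if "n \<ge> 1" for n k
    using ext_expectation_approx[where f = f and g = "\<lambda>k x. c k * (1 + (norm x)\<^sup>2)" and k = k,
        OF rT fC quadratic_weight_C_lLip f, of n] c0[of K]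
    by (simp add: T2[OF that])
  have extZ: "\<bar>ext_expectation E' \<phi> Z - E' (\<lambda>\<omega>. f k (Z \<omega>))\<bar> \<le> c k * K'" for k
    using E'.ext_expectation_approx[where f = f and g = "\<lambda>k x. c k * (1 + (norm x)\<^sup>2)" and k = k,
        OF rZ fC quadratic_weight_C_lLip f] c0[of K']
    by (simp add: Z2)
  have "(\<lambda>n. ext_expectation E \<phi> (T n)) \<longlonglongrightarrow> ext_expectation E' \<phi> Z"
  proof (rule LIMSEQ_I)
    fix e :: real
    assume e: "0 < e"
    \<comment> \<open>\<open>k\<close> can be fixed before \<open>n\<close>, because both
      replacement errors are uniform in \<open>n \<ge> 1\<close>; the last third of \<open>e\<close>
      is left for convergence at the bounded Lipschitz function \<open>f k\<close>.\<close>
    have "eventually (\<lambda>k. c k * K < e / 3 \<and> c k * K' < e / 3) sequentially"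
      using e by (intro eventually_conj order_tendstoD(2)[OF c0]) auto
    then obtain k where k: "c k * K < e / 3" "c k * K' < e / 3"
      by (auto simp: eventually_sequentially)
    have "(\<lambda>n. E (\<lambda>\<omega>. f k (T n \<omega>))) \<longlonglongrightarrow> E' (\<lambda>\<omega>. f k (Z \<omega>))"
      using central_limit_bounded_lipschitz[OF mean assms(7-9)] fb[of k] unfolding T_def by blast
    then obtain N where N: "\<And>n. n \<ge> N \<Longrightarrow> \<bar>E (\<lambda>\<omega>. f k (T n \<omega>)) - E' (\<lambda>\<omega>. f k (Z \<omega>))\<bar> < e / 3"
      using LIMSEQ_D[of "\<lambda>n. E (\<lambda>\<omega>. f k (T n \<omega>))" "E' (\<lambda>\<omega>. f k (Z \<omega>))" "e / 3"] e by auto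
    show "\<exists>N. \<forall>n\<ge>N. norm (ext_expectation E \<phi> (T n) - ext_expectation E' \<phi> Z) < e"
    proof (intro exI allI impI)
      fix n
      assume n: "max 1 N \<le> n"
      then have "1 \<le> n" "N \<le> n" by simp_all
      then show "norm (ext_expectation E \<phi> (T n) - ext_expectation E' \<phi> Z) < e"
        using extT[of n k] extZ[of k] N[of n] k unfolding real_norm_def by linarith
    qed
  qed
  then show ?thesis by (simp add: T_def[abs_def] S_def)
qed

end
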